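(* Let $\delta\ge 0$ be a known integer and suppose the following hold. (Irreversibility) $D_1=0$ a.s., and for $t=2,\dots,\mathcal T$, $D_{t-1}=1$ implies $D_t=1$ a.s. (Random sampling) $\{(Y_{i,1},\dots,Y_{i,\mathcal T},X_i,D_{i,1},\dots,D_{i,\mathcal T})\}_{i=1}^n$ is i.i.d. with the law of $(Y_1,\dots,Y_{\mathcal T},X,D_1,\dots,D_{\mathcal T})$. (Limited anticipation) $\mathbb E[Y_t(g)\mid X,G_g=1]=\mathbb E[Y_t(0)\mid X,G_g=1]$ a.s. for all $g\in\mathcal G$ and $t\in\{1,\dots,\mathcal T\}$ with $t<g-\delta$. (Overlap) For each $t\in\{2,\dots,\mathcal T\}$ and $g\in\mathcal G$ there is $\varepsilon>0$ such that $P(G_g=1)>\varepsilon$ and $p_{g,t}(X)<1-\varepsilon$ a.s. Then: (i) If (conditional parallel trends based on the never-treated group) for each $g\in\mathcal G$ and $t\in\{2,\dots,\mathcal T\}$ with $t\ge g-\delta$, $$\mathbb E[Y_t(0)-Y_{t-1}(0)\mid X,G_g=1]=\mathbb E[Y_t(0)-Y_{t-1}(0)\mid X,C=1]\quad\text{a.s.},$$ then for all $g\in\mathcal G_\delta$ and $t\in\{2,\dots,\mathcal T-\delta\}$ with $t\ge g-\delta$, $$ATT(g,t)=ATT^{nev}_{ipw}(g,t;\delta)=ATT^{nev}_{or}(g,t;\delta)=ATT^{nev}_{dr}(g,t;\delta).$$ (ii) If (conditional parallel trends based on not-yet-treated groups) for each $g\in\mathcal G$ and each $(s,t)\in\{2,\dots,\mathcal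 T\}^2$ with $t\ge g-\delta$ and $t+\delta\le s<\bar g$, $$\mathbb E[Y_t(0)-Y_{t-1}(0)\mid X,G_g=1]=\mathbb E[Y_t(0)-Y_{t-1}(0)\mid X,D_s=0,G_g=0]\quad\text{a.s.},$$ then for all $g\in\mathcal G_\delta$ and $t\in\{2,\dots,\mathcal T-\delta\}$ with $g-\delta\le t<\bar g-\delta$, $$ATT(g,t)=ATT^{ny}_{ipw}(g,t;\delta)=ATT^{ny}_{or}(g,t;\delta)=ATT^{ny}_{dr}(g,t;\delta).$$
   Context: Setup. There are $\mathcal T\ge 2$ time periods $t=1,\dots,\mathcal T$. $D_t\in\{0,1\}$ indicates being treated in period $t$; $X$ is a vector of pre-treatment covariates in $\mathbb R^k$. $G$ is the period in which the unit is first treated, with $G=\infty$ if it is never treated in periods $1,\dots,\mathcal T$. $G_g=\mathbf 1\{G=g\}$ and $C=\mathbf 1\{G=\infty\}=1-D_{\mathcal T}$. $\bar g$ is the largest value in the support of $G$ (equal to $\infty$ if there are never-treated units), with the convention $\bar g-\delta=\infty$ if $\bar g=\infty$. $\mathcal G=\operatorname{supp}(G)\setminus\{\bar g\}\subseteq\{2,\dots,\mathcal T\}$ and $\mathcal G_\delta=\mathcal G\cap\{2+\delta,3+\delta,\dots,\mathcal T\}$. Potential outcomes: $Y_t(0)$ is the outcome at time $t$ if never treated through $\mathcal T$; $Y_t(g)$, $g=2,\dots,\mathcal T$, is the outcome at $t$ if first treated in period $g$. The observed outcome is $Y_t=Y_t(0)+\sum_{g=2}^{\mathcal T}(Y_t(g)-Y_t(0))G_g$.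 All expectations that appear are assumed to exist. The group-time average treatment effect is $ATT(g,t)=\mathbb E[Y_t(g)-Y_t(0)\mid G_g=1]$. Generalized propensity score: $p_{g,s}(X)=P(G_g=1\mid X,\,G_g+(1-D_s)(1-G_g)=1)$ and $p_g(X)=p_{g,\mathcal T}(X)=P(G_g=1\mid X,G_g+C=1)$. Conditional quantities given $X$ and an event are understood at values of $X$ where that event has positive conditional probability given $X$ (and are set to $0$, say, elsewhere); a.s. equalities between such quantities are required where both are defined. Outcome regressions: $m^{nev}_{g,t,\delta}(X)=\mathbb E[Y_t-Y_{g-\delta-1}\mid X,C=1]$ and $m^{ny}_{g,t,\delta}(X)=\mathbb E[Y_t-Y_{g-\delta-1}\mid X,D_{t+\delta}=0,G_g=0]$. Weights: $w^{treat}_g=G_g/\mathbb E[G_g]$, $$w^{nev}_g=\frac{p_g(X)C}{1-p_g(X)}\Big/\mathbb E\Big[\frac{p_g(X)C}{1-p_g(X)}\Big],\qquad w^{ny}_{g,t}=\frac{p_{g,t+\delta}(X)(1-D_{t+\delta})(1-G_g)}{1-p_{g,t+\delta}(X)}\Big/\mathbb E\Big[\frac{p_{g,t+\delta}(X)(1-D_{t+\delta})(1-G_g)}{1-p_{g,t+\delta}(X)}\Big].$$ Estimands: $ATT^{nev}_{ipw}(g,t;\delta)=\mathbb E[(w^{treat}_g-w^{nev}_g)(Y_t-Y_{g-\delta-1})]$; $ATT^{nev}_{or}(g,t;\delta)=\mathbb E[w^{treat}_g(Y_t-Y_{g-\delta-1}-m^{nev}_{g,t,\delta}(X))]$; $ATT^{nev}_{dr}(g,t;\delta)=\mathbb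 E[(w^{treat}_g-w^{nev}_g)(Y_t-Y_{g-\delta-1}-m^{nev}_{g,t,\delta}(X))]$; $ATT^{ny}_{ipw}(g,t;\delta)=\mathbb E[(w^{treat}_g-w^{ny}_{g,t})(Y_t-Y_{g-\delta-1})]$; $ATT^{ny}_{or}(g,t;\delta)=\mathbb E[w^{treat}_g(Y_t-Y_{g-\delta-1}-m^{ny}_{g,t,\delta}(X))]$; $ATT^{ny}_{dr}(g,t;\delta)=\mathbb E[(w^{treat}_g-w^{ny}_{g,t})(Y_t-Y_{g-\delta-1}-m^{ny}_{g,t,\delta}(X))]$. *)

theory Defs
  imports "HOL-Probability.Probability"
begin

text \<open>
  \<open>D t\<close> is the treatment indicator of period \<open>t\<close>, \<open>X\<close> the covariate vector, and \<open>Y t g\<close> the potential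
  outcome of period \<open>t\<close> when first treated in period \<open>g\<close>; as in the usual notation \<open>Y\<^sub>t(0)\<close>, the index
  \<open>g = 0\<close> stands for never being treated. Only the indices \<open>1 \<le> t \<le> T\<close> and \<open>g \<in> {0, 2, \<dots>, T}\<close> matter.
\<close>

locale staggered_adoption = prob_space M
  for M :: "'a measure" +
  fixes T :: nat
    and D :: "nat \<Rightarrow> 'a \<Rightarrow> real"
    and X :: "'a \<Rightarrow> real ^ 'k"
    and Y :: "nat \<Rightarrow> nat \<Rightarrow> 'a \<Rightarrow> real"
  assumes T_ge_2: "2 \<le> T"
    and D_measurable: "t \<in> {1..T} \<Longrightarrow> D t \<in> borel_measurable M"
    and D_binary: "t \<in> {1..T} \<Longrightarrow> \<omega> \<in> space M \<Longrightarrow> D t \<omega> \<in> {0, 1}"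
    and X_measurable: "X \<in> borel_measurable M"
    and Y_measurable: "t \<in> {1..T} \<Longrightarrow> g \<in> insert 0 {2..T} \<Longrightarrow> Y t g \<in> borel_measurable M"
begin

text \<open>The infimum of the empty set of type \<^typ>\<open>enat\<close> is \<open>\<infinity>\<close>: never-treated units have \<open>G = \<infinity>\<close>.\<close>

definition G :: "'a \<Rightarrow> enat" where
  "G \<omega> = Inf (enat ` {t \<in> {1..T}. D t \<omega> = 1})"

definition Gind :: "nat \<Rightarrow> 'a \<Rightarrow> real" where
  "Gind g \<omega> = of_bool (G \<omega> = enat g)"

definition C :: "'a \<Rightarrow> real" where
  "C \<omega> = of_bool (G \<omega> = \<infinity>)"

definition suppG :: "enat set" where
  "suppG = {g. prob {\<omega> \<in> space M. G \<omega> = g} > 0}"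

definition gbar :: enat where
  "gbar = Max suppG"

definition groups :: "nat set" where
  "groups = {g. enat g \<in> suppG - {gbar}}"

definition groups_from :: "nat \<Rightarrow> nat set" where
  "groups_from \<delta> = groups \<inter> {2 + \<delta>..T}"

definition Yobs :: "nat \<Rightarrow> 'a \<Rightarrow> real" where
  "Yobs t \<omega> = Y t 0 \<omega> + (\<Sum>g = 2..T. (Y t g \<omega> - Y t 0 \<omega>) * Gind g \<omega>)"

definition treated_in :: "nat \<Rightarrow> 'a set" where
  "treated_in g = {\<omega> \<in> space M. Gind g \<omega> = 1}"

definition never_treated :: "'a set" where
  "never_treated = {\<omega> \<in> space M. C \<omega> = 1}"

definition not_yet_treated :: "nat \<Rightarrow> nat \<Rightarrow> 'a set" where
  "not_yet_treated g s = {\<omega> \<in> space M. D s \<omega> = 0 \<and> Gind g \<omega> = 0}"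

definition sigmaX :: "'a measure" where
  "sigmaX = vimage_algebra (space M) X borel"

definition probX :: "'a set \<Rightarrow> 'a \<Rightarrow> real" where
  "probX A = real_cond_exp M sigmaX (indicator A)"

text \<open>
  The conditional expectation of \<open>Z\<close> given \<open>X\<close> and the event \<open>A\<close> is the conditional expectation given \<open>X\<close>
  under the conditional law given \<open>A\<close>. Under \<open>M\<close> it is determined almost surely only where the
  conditional probability of \<open>A\<close> given \<open>X\<close> is positive; elsewhere it is set to \<open>0\<close>.
\<close>

definition cexpX :: "('a \<Rightarrow> real) \<Rightarrow> 'a set \<Rightarrow> 'a \<Rightarrow> real" where
  "cexpX Z A \<omega> =
     (if probX A \<omega> > 0 then real_cond_exp (uniform_measure M A) sigmaX Z \<omega> else 0)"

text \<open>
  Both conditional expectations exist, and they agree almost surely where both are defined.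
\<close>

definition cexpX_eq :: "('a \<Rightarrow> real) \<Rightarrow> 'a set \<Rightarrow> ('a \<Rightarrow> real) \<Rightarrow> 'a set \<Rightarrow> bool" where
  "cexpX_eq Z A Z' A' \<longleftrightarrow>
     integrable (uniform_measure M A) Z \<and> integrable (uniform_measure M A') Z' \<and>
     (AE \<omega> in M. probX A \<omega> > 0 \<longrightarrow> probX A' \<omega> > 0 \<longrightarrow> cexpX Z A \<omega> = cexpX Z' A' \<omega>)"

definition ATT :: "nat \<Rightarrow> nat \<Rightarrow> real" where
  "ATT g t = integral\<^sup>L (uniform_measure M (treated_in g)) (\<lambda>\<omega>. Y t g \<omega> - Y t 0 \<omega>)"

definition ATT_exists :: "nat \<Rightarrow> nat \<Rightarrow> bool" where
  "ATT_exists g t \<longleftrightarrow> integrable (uniform_measure M (treated_in g)) (\<lambda>\<omega>. Y t g \<omega> - Y t 0 \<omega>)"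

text \<open>\<open>pscore g T\<close> is the propensity score \<open>p\<^sub>g\<close>: almost surely \<open>1 - D T = C\<close>.\<close>

definition pscore :: "nat \<Rightarrow> nat \<Rightarrow> 'a \<Rightarrow> real" where
  "pscore g s =
     cexpX (indicator (treated_in g)) {\<omega> \<in> space M. Gind g \<omega> + (1 - D s \<omega>) * (1 - Gind g \<omega>) = 1}"

definition m_nev :: "nat \<Rightarrow> nat \<Rightarrow> nat \<Rightarrow> 'a \<Rightarrow> real" where
  "m_nev g t \<delta> = cexpX (\<lambda>\<omega>. Yobs t \<omega> - Yobs (g - \<delta> - 1) \<omega>) never_treated"

definition m_ny :: "nat \<Rightarrow> nat \<Rightarrow> nat \<Rightarrow> 'a \<Rightarrow> real" where
  "m_ny g t \<delta> = cexpX (\<lambda>\<omega>. Yobs t \<omega> - Yobs (g - \<delta> - 1) \<omega>) (not_yet_treated g (t + \<delta>))"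

definition w_treat :: "nat \<Rightarrow> 'a \<Rightarrow> real" where
  "w_treat g \<omega> = Gind g \<omega> / expectation (Gind g)"

definition odds_nev :: "nat \<Rightarrow> 'a \<Rightarrow> real" where
  "odds_nev g \<omega> = pscore g T \<omega> * C \<omega> / (1 - pscore g T \<omega>)"

definition w_nev :: "nat \<Rightarrow> 'a \<Rightarrow> real" where
  "w_nev g \<omega> = odds_nev g \<omega> / expectation (odds_nev g)"

definition odds_ny :: "nat \<Rightarrow> nat \<Rightarrow> 'a \<Rightarrow> real" where
  "odds_ny g s \<omega> = pscore g s \<omega> * (1 - D s \<omega>) * (1 - Gind g \<omega>) / (1 - pscore g s \<omega>)"

definition w_ny :: "nat \<Rightarrow> nat \<Rightarrow> nat \<Rightarrow> 'a \<Rightarrow> real" where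
  "w_ny g t \<delta> \<omega> = odds_ny g (t + \<delta>) \<omega> / expectation (odds_ny g (t + \<delta>))"

definition ATT_nev_ipw :: "nat \<Rightarrow> nat \<Rightarrow> nat \<Rightarrow> real" where
  "ATT_nev_ipw g t \<delta> =
     expectation (\<lambda>\<omega>. (w_treat g \<omega> - w_nev g \<omega>) * (Yobs t \<omega> - Yobs (g - \<delta> - 1) \<omega>))"

definition ATT_nev_or :: "nat \<Rightarrow> nat \<Rightarrow> nat \<Rightarrow> real" where
  "ATT_nev_or g t \<delta> =
     expectation (\<lambda>\<omega>. w_treat g \<omega> * (Yobs t \<omega> - Yobs (g - \<delta> - 1) \<omega> - m_nev g t \<delta> \<omega>))"

definition ATT_nev_dr :: "nat \<Rightarrow> nat \<Rightarrow> nat \<Rightarrow> real" where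
  "ATT_nev_dr g t \<delta> =
     expectation (\<lambda>\<omega>. (w_treat g \<omega> - w_nev g \<omega>) *
       (Yobs t \<omega> - Yobs (g - \<delta> - 1) \<omega> - m_nev g t \<delta> \<omega>))"

definition ATT_ny_ipw :: "nat \<Rightarrow> nat \<Rightarrow> nat \<Rightarrow> real" where
  "ATT_ny_ipw g t \<delta> =
     expectation (\<lambda>\<omega>. (w_treat g \<omega> - w_ny g t \<delta> \<omega>) * (Yobs t \<omega> - Yobs (g - \<delta> - 1) \<omega>))"

definition ATT_ny_or :: "nat \<Rightarrow> nat \<Rightarrow> nat \<Rightarrow> real" where
  "ATT_ny_or g t \<delta> =
     expectation (\<lambda>\<omega>. w_treat g \<omega> * (Yobs t \<omega> - Yobs (g - \<delta> - 1) \<omega> - m_ny g t \<delta> \<omega>))"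

definition ATT_ny_dr :: "nat \<Rightarrow> nat \<Rightarrow> nat \<Rightarrow> real" where
  "ATT_ny_dr g t \<delta> =
     expectation (\<lambda>\<omega>. (w_treat g \<omega> - w_ny g t \<delta> \<omega>) *
       (Yobs t \<omega> - Yobs (g - \<delta> - 1) \<omega> - m_ny g t \<delta> \<omega>))"

definition irreversibility :: bool where
  "irreversibility \<longleftrightarrow>
     (AE \<omega> in M. D 1 \<omega> = 0) \<and> (\<forall>t\<in>{2..T}. AE \<omega> in M. D (t - 1) \<omega> = 1 \<longrightarrow> D t \<omega> = 1)"

definition obs_space :: "((nat \<Rightarrow> real) \<times> (real ^ 'k) \<times> (nat \<Rightarrow> real)) measure" where
  "obs_space = (\<Pi>\<^sub>M t\<in>{1..T}. borel) \<Otimes>\<^sub>M borel \<Otimes>\<^sub>M (\<Pi>\<^sub>M t\<in>{1..T}. borel)"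

text \<open>
  The sample of size \<open>n\<close> may live on a probability space \<open>N\<close> of its own;
  \<open>Ys i t\<close>, \<open>Xs i\<close>, \<open>Ds i t\<close> are the observations of unit \<open>i\<close>.
\<close>

definition random_sampling ::
  "'b measure \<Rightarrow> nat \<Rightarrow> (nat \<Rightarrow> nat \<Rightarrow> 'b \<Rightarrow> real) \<Rightarrow> (nat \<Rightarrow> 'b \<Rightarrow> real ^ 'k) \<Rightarrow>
   (nat \<Rightarrow> nat \<Rightarrow> 'b \<Rightarrow> real) \<Rightarrow> bool" where
  "random_sampling N n Ys Xs Ds \<longleftrightarrow>
     prob_space N \<and>
     prob_space.indep_vars N (\<lambda>_. obs_space)
       (\<lambda>i \<omega>. (\<lambda>t\<in>{1..T}. Ys i t \<omega>, Xs i \<omega>, \<lambda>t\<in>{1..T}. Ds i t \<omega>)) {1..n} \<and>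
     (\<forall>i\<in>{1..n}.
        distr N obs_space (\<lambda>\<omega>. (\<lambda>t\<in>{1..T}. Ys i t \<omega>, Xs i \<omega>, \<lambda>t\<in>{1..T}. Ds i t \<omega>)) =
        distr M obs_space (\<lambda>\<omega>. (\<lambda>t\<in>{1..T}. Yobs t \<omega>, X \<omega>, \<lambda>t\<in>{1..T}. D t \<omega>)))"

text \<open>
  Below, \<open>t < g - \<delta>\<close> is written \<open>t + \<delta> < g\<close>, and \<open>t \<ge> g - \<delta>\<close> is written \<open>g \<le> t + \<delta>\<close>,
  to avoid truncated subtraction.
\<close>

definition limited_anticipation :: "nat \<Rightarrow> bool" where
  "limited_anticipation \<delta> \<longleftrightarrow>
     (\<forall>g\<in>groups. \<forall>t\<in>{1..T}. t + \<delta> < g \<longrightarrow>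
        cexpX_eq (Y t g) (treated_in g) (Y t 0) (treated_in g))"

definition overlap :: bool where
  "overlap \<longleftrightarrow>
     (\<forall>t\<in>{2..T}. \<forall>g\<in>groups. \<exists>\<epsilon>>0.
        prob (treated_in g) > \<epsilon> \<and> (AE \<omega> in M. pscore g t \<omega> < 1 - \<epsilon>))"

definition parallel_trends_nev :: "nat \<Rightarrow> bool" where
  "parallel_trends_nev \<delta> \<longleftrightarrow>
     (\<forall>g\<in>groups. \<forall>t\<in>{2..T}. g \<le> t + \<delta> \<longrightarrow>
        cexpX_eq (\<lambda>\<omega>. Y t 0 \<omega> - Y (t - 1) 0 \<omega>) (treated_in g)
                 (\<lambda>\<omega>. Y t 0 \<omega> - Y (t - 1) 0 \<omega>) never_treated)"

definition parallel_trends_ny :: "nat \<Rightarrow> bool" where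
  "parallel_trends_ny \<delta> \<longleftrightarrow>
     (\<forall>g\<in>groups. \<forall>s\<in>{2..T}. \<forall>t\<in>{2..T}. g \<le> t + \<delta> \<longrightarrow> t + \<delta> \<le> s \<longrightarrow> enat s < gbar \<longrightarrow>
        cexpX_eq (\<lambda>\<omega>. Y t 0 \<omega> - Y (t - 1) 0 \<omega>) (treated_in g)
                 (\<lambda>\<omega>. Y t 0 \<omega> - Y (t - 1) 0 \<omega>) (not_yet_treated g s))"

end

end

(*
  Fix a group g, a control event B disjoint from A = {G = g}, and let p be the propensity score of A
  given A \<union> B. Since p = P(A | X) / (P(A | X) + P(B | X)), the odds r = p / (1 - p), which are bounded
  by overlap, satisfy r P(B | X) = P(A | X). Hence weighting by r 1_B replaces the control group by one
  with the covariate distribution of A: E[r 1_B f] = E[1_A E[f | X, B]]. So if E[Z | X, B] = E[W | X, A],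
  all three estimands are E[1_A (Z - W)] / P(A).

  Here Z is the observed change of the outcome since period b = g - \<delta> - 1, and W is the change of the
  untreated potential outcome. The hypothesis on Z and W is obtained by adding up parallel trends over
  the periods b + 1, ..., t; on the groups of B that are treated later than t + \<delta>, limited anticipation
  lets Y(h) be replaced by Y(0). Limited anticipation for g itself in period b turns E[1_A (Z - W)] / P(A)
  into ATT(g, t).

  Overlap in period T forces P(C = 1) > 0 as soon as there is a group at all, so that gbar is infinite.
*)

theory Submission
  imports Defs
begin

subsection \<open>Conditioning on an event\<close>

text \<open>The product is dominated by \<open>K * f\<close>. The factor \<open>r\<close> will be
  the odds of the propensity score, which overlap bounds.\<close>

lemma integrable_mult_AE_bounded:
  fixes f r :: "'a \<Rightarrow> real"
  assumes "integrable M f" "r \<in> borel_measurable M" "AE \<omega> in M. 0 \<le> r \<omega> \<and> r \<omega> \<le> K"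
  shows "integrable M (\<lambda>\<omega>. r \<omega> * f \<omega>)"
proof (rule Bochner_Integration.integrable_bound[of _ "\<lambda>\<omega>. K * f \<omega>"])
  show "AE \<omega> in M. norm (r \<omega> * f \<omega>) \<le> norm (K * f \<omega>)"
    using assms(3) by eventually_elim (auto simp: abs_mult intro!: mult_right_mono)
qed (use assms in auto)

text \<open>The conditional law given \<open>A\<close> has density
  \<open>indicator A / prob A\<close> with respect to \<open>M\<close>. Both facts serve to leave
  \<open>uniform_measure\<close> and to compute under \<open>M\<close> with the indicator as a
  factor.\<close>

lemma (in prob_space)
  fixes Z :: "'a \<Rightarrow> real"
  assumes "A \<in> events" "prob A > 0" "Z \<in> borel_measurable M"
  shows integrable_uniform_measure_iff:
      "integrable (uniform_measure M A) Z \<longleftrightarrow> integrable M (\<lambda>\<omega>. indicator A \<omega> * Z \<omega>)"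
    and integral_uniform_measure:
      "integral\<^sup>L (uniform_measure M A) Z = (\<integral>\<omega>. indicator A \<omega> * Z \<omega> \<partial>M) / prob A"
proof -
  have *: "uniform_measure M A = density M (\<lambda>\<omega>. ennreal (indicator A \<omega> / prob A))"
    unfolding uniform_measure_def using assms
    by (intro arg_cong[where f="density M"])
       (auto simp: fun_eq_iff emeasure_eq_measure divide_ennreal[symmetric] split: split_indicator)
  have m: "(\<lambda>\<omega>. indicator A \<omega> / prob A) \<in> borel_measurable M"
    using assms by measurable
  have nn: "AE \<omega> in M. 0 \<le> indicator A \<omega> / prob A"
    by simp
  have eq: "indicator A \<omega> / prob A * Z \<omega> = (1 / prob A) * (indicator A \<omega> * Z \<omega>)" for \<omega>
    by simp
  show "integrable (uniform_measure M A) Z \<longleftrightarrow> integrable M (\<lambda>\<omega>. indicator A \<omega> * Z \<omega>)"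
    unfolding * integrable_density[OF assms(3) m nn] real_scaleR_def eq
    using assms(2) by (subst integrable_mult_left_iff) auto
  show "integral\<^sup>L (uniform_measure M A) Z = (\<integral>\<omega>. indicator A \<omega> * Z \<omega> \<partial>M) / prob A"
    unfolding * integral_density[OF assms(3) m nn] real_scaleR_def eq by simp
qed

text \<open>Bayes' formula for conditional expectations. On the part of \<open>A\<close> in any set
  of \<open>F\<close>, \<open>Z\<close> and its conditional expectation \<open>E\<close> under the
  conditional law have the same integral. Pulling the \<open>F\<close>-measurable factor
  \<open>E\<close> out of the conditional expectation of \<open>E\<close> times the indicator leaves
  the conditional probability of \<open>A\<close>.\<close>

lemma (in prob_space) real_cond_exp_uniform_measure:
  fixes Z :: "'a \<Rightarrow> real"
  assumes F: "subalgebra M F" and A: "A \<in> events" "prob A > 0"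
    and Z: "integrable (uniform_measure M A) Z"
  shows "AE \<omega> in M. real_cond_exp M F (\<lambda>\<omega>. indicator A \<omega> * Z \<omega>) \<omega> =
    real_cond_exp M F (indicator A) \<omega> * real_cond_exp (uniform_measure M A) F Z \<omega>"
proof -
  define U where "U = uniform_measure M A"
  define E where "E = real_cond_exp U F Z"
  interpret finite_measure_subalgebra M F
    by unfold_locales (rule F)
  interpret U: prob_space U
    unfolding U_def using A by (intro prob_space_uniform_measure) (auto simp: emeasure_eq_measure)
  interpret U: finite_measure_subalgebra U F
    using F by unfold_locales (simp add: subalgebra_def U_def)
  note [measurable] = A(1)
  have ZM [measurable]: "Z \<in> borel_measurable M"
    using borel_measurable_integrable[OF Z] by simp
  have EF [measurable]: "E \<in> borel_measurable F"
    unfolding E_def by simp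
  have EM [measurable]: "E \<in> borel_measurable M"
    by (rule measurable_from_subalg[OF F EF])
  have "integrable U E"
    unfolding E_def using Z by (intro U.real_cond_exp_int) (simp add: U_def)
  then have iE: "integrable M (\<lambda>\<omega>. indicator A \<omega> * E \<omega>)"
    unfolding U_def by (simp add: integrable_uniform_measure_iff[OF A])
  have iZ: "integrable M (\<lambda>\<omega>. indicator A \<omega> * Z \<omega>)"
    using Z by (simp add: integrable_uniform_measure_iff[OF A])
  let ?c = "real_cond_exp M F (\<lambda>\<omega>. E \<omega> * indicator A \<omega>)"
  have c1: "AE \<omega> in M. ?c \<omega> = E \<omega> * real_cond_exp M F (indicator A) \<omega>"
    using iE by (intro real_cond_exp_mult) (auto simp: mult.commute)
  \<comment> \<open>On a set \<open>S\<close> of \<open>F\<close> the comparison makes a detour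
    through the conditional law \<open>U\<close>: there \<open>E\<close> may replace
    \<open>Z\<close>, and the factor \<open>prob A\<close> that appears on the way in cancels on the
    way out.\<close>
  have c2: "AE \<omega> in M. real_cond_exp M F (\<lambda>\<omega>. indicator A \<omega> * Z \<omega>) \<omega> = ?c \<omega>"
  proof (rule real_cond_exp_charact)
    fix S assume S: "S \<in> sets F"
    then have SM [measurable]: "S \<in> sets M"
      using F by (auto simp: subalgebra_def)
    have "(\<integral>\<omega>\<in>S. indicator A \<omega> * Z \<omega> \<partial>M) = prob A * (\<integral>\<omega>\<in>S. Z \<omega> \<partial>U)"
      unfolding set_lebesgue_integral_def U_def
      using A by (subst integral_uniform_measure[OF A]) (auto simp: ac_simps)
    also have "(\<integral>\<omega>\<in>S. Z \<omega> \<partial>U) = (\<integral>\<omega>\<in>S. E \<omega> \<partial>U)"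
      unfolding E_def using Z S by (intro U.real_cond_exp_intA) (auto simp: U_def)
    also have "prob A * (\<integral>\<omega>\<in>S. E \<omega> \<partial>U) = (\<integral>\<omega>\<in>S. E \<omega> * indicator A \<omega> \<partial>M)"
      unfolding set_lebesgue_integral_def U_def
      using A by (subst integral_uniform_measure[OF A]) (auto simp: ac_simps)
    also have "\<dots> = (\<integral>\<omega>\<in>S. ?c \<omega> \<partial>M)"
      using iE S by (intro real_cond_exp_intA) (auto simp: mult.commute)
    finally show "(\<integral>\<omega>\<in>S. indicator A \<omega> * Z \<omega> \<partial>M) = (\<integral>\<omega>\<in>S. ?c \<omega> \<partial>M)" .
  qed (use iE iZ in \<open>auto intro!: real_cond_exp_int simp: mult.commute\<close>)
  show ?thesis
    using c1 c2 by eventually_elim (simp add: E_def U_def)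
qed

lemma (in prob_space) integrable_indicator_event:
  "A \<in> events \<Longrightarrow> integrable M (indicat_real A)"
  by (simp add: integrable_indicator_iff emeasure_eq_measure)

section \<open>Conditional expectations given the covariates and an event\<close>

context staggered_adoption
begin

lemma subalgebra_sigmaX: "subalgebra M sigmaX"
  unfolding sigmaX_def subalgebra_def
  using X_measurable by (auto simp: sets_vimage_algebra2 measurable_sets)

interpretation sigmaX: finite_measure_subalgebra M sigmaX
  by unfold_locales (rule subalgebra_sigmaX)

lemma borel_measurable_sigmaX_M: "f \<in> borel_measurable sigmaX \<Longrightarrow> f \<in> borel_measurable M"
  by (rule measurable_from_subalg[OF subalgebra_sigmaX])

lemma probX_measurable [measurable]: "probX A \<in> borel_measurable sigmaX"
  unfolding probX_def by simp

lemma cexpX_measurable [measurable]: "cexpX Z A \<in> borel_measurable sigmaX"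
proof -
  have [measurable]: "real_cond_exp (uniform_measure M A) sigmaX Z \<in> borel_measurable sigmaX"
    by simp
  show ?thesis
    unfolding cexpX_def[abs_def] by measurable
qed

lemma probX_measurable_M [measurable]: "probX A \<in> borel_measurable M"
  by (rule borel_measurable_sigmaX_M) simp

lemma cexpX_measurable_M [measurable]: "cexpX Z A \<in> borel_measurable M"
  by (rule borel_measurable_sigmaX_M) simp

lemma probX_nonneg: "A \<in> events \<Longrightarrow> AE \<omega> in M. 0 \<le> probX A \<omega>"
  unfolding probX_def by (rule sigmaX.real_cond_exp_pos) auto

lemma integral_mult_probX:
  assumes "A \<in> events" "f \<in> borel_measurable sigmaX" "integrable M (\<lambda>\<omega>. f \<omega> * indicator A \<omega>)"
  shows "(\<integral>\<omega>. f \<omega> * probX A \<omega> \<partial>M) = (\<integral>\<omega>. f \<omega> * indicator A \<omega> \<partial>M)"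
  unfolding probX_def using assms by (auto intro: sigmaX.real_cond_exp_intg(2))

lemma integral_probX:
  assumes "A \<in> events"
  shows "(\<integral>\<omega>. probX A \<omega> \<partial>M) = prob A"
  using integral_mult_probX[OF assms, of "\<lambda>_. 1"] assms
  by (simp add: integrable_indicator_iff emeasure_eq_measure)

text \<open>The set \<open>S\<close> where \<open>probX A\<close> is not positive is determined by
  \<open>X\<close>, so the integral of \<open>probX A\<close> over it is
  \<open>prob (S \<inter> A)\<close>; it is also at most 0. Hence, up to a null set,
  \<open>cexpX\<close> given \<open>A\<close> never takes its default value on
  \<open>A\<close>.\<close>

lemma AE_probX_pos:
  assumes [measurable]: "A \<in> events"
  shows "AE \<omega> in M. \<omega> \<in> A \<longrightarrow> probX A \<omega> > 0"
proof -
  define S where "S = {\<omega> \<in> space M. probX A \<omega> \<le> 0}"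
  have [measurable]: "S \<in> sets M"
    unfolding S_def by measurable
  \<comment> \<open>A test function for \<open>probX\<close> has to be measurable with respect to
    \<open>sigmaX\<close>, not merely to \<open>M\<close>.\<close>
  have "indicator S \<in> borel_measurable sigmaX"
  proof -
    have "space sigmaX = space M"
      using subalgebra_sigmaX by (simp add: subalgebra_def)
    then have "S = {\<omega> \<in> space sigmaX. probX A \<omega> \<le> 0}"
      by (simp add: S_def)
    then show ?thesis by simp
  qed
  then have "(\<integral>\<omega>. indicator S \<omega> * probX A \<omega> \<partial>M) = (\<integral>\<omega>. indicator S \<omega> * indicator A \<omega> \<partial>M)"
    by (intro integral_mult_probX)
       (auto intro!: integrable_real_mult_indicator simp: integrable_indicator_iff emeasure_eq_measure)
  also have "\<dots> = prob (S \<inter> A)"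
    by (simp flip: indicator_inter_arith)
  finally have "(\<integral>\<omega>. indicator S \<omega> * probX A \<omega> \<partial>M) = prob (S \<inter> A)" .
  moreover have "(\<integral>\<omega>. indicator S \<omega> * probX A \<omega> \<partial>M) \<le> 0"
  proof -
    have "(\<integral>\<omega>. indicator S \<omega> * probX A \<omega> \<partial>M) \<le> (\<integral>\<omega>. 0 \<partial>M)"
      by (rule integral_mono_AE')
         (auto simp: S_def split: split_indicator)
    then show ?thesis by simp
  qed
  ultimately have "prob (S \<inter> A) = 0"
    using measure_nonneg[of M "S \<inter> A"] by linarith
  then have "AE \<omega> in M. \<omega> \<notin> S \<inter> A"
    by (subst prob_eq_0[symmetric]) auto
  with AE_space show ?thesis
    by eventually_elim (auto simp: S_def)
qed

text \<open>The unnormalised form of \<open>cexpX\<close>. It is taken under \<open>M\<close>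
  whatever the event is, so linearity and congruence of conditional expectations apply to it
  directly.\<close>

abbreviation cexp_on :: "('a \<Rightarrow> real) \<Rightarrow> 'a set \<Rightarrow> 'a \<Rightarrow> real" where
  "cexp_on Z A \<equiv> real_cond_exp M sigmaX (\<lambda>\<omega>. indicator A \<omega> * Z \<omega>)"

text \<open>Bayes' formula once more. Where \<open>probX A\<close> is not positive it is almost
  surely 0, so both sides vanish and the default value in \<open>cexpX\<close> is harmless.\<close>

lemma cexp_on_eq:
  assumes "A \<in> events" "prob A > 0" "integrable (uniform_measure M A) Z"
  shows "AE \<omega> in M. cexp_on Z A \<omega> = probX A \<omega> * cexpX Z A \<omega>"
  using real_cond_exp_uniform_measure[OF subalgebra_sigmaX assms] probX_nonneg[OF assms(1)]
  by eventually_elim (auto simp: cexpX_def probX_def)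

text \<open>Dividing \<open>cexp_on\<close> by \<open>probX\<close> recovers \<open>cexpX\<close>
  where it is defined. This expresses a comparison across two conditional laws by conditional
  expectations under \<open>M\<close> only.\<close>

lemma cexpX_eq_iff:
  assumes "A \<in> events" "prob A > 0" "A' \<in> events" "prob A' > 0"
  shows "cexpX_eq Z A Z' A' \<longleftrightarrow>
    integrable (uniform_measure M A) Z \<and> integrable (uniform_measure M A') Z' \<and>
    (AE \<omega> in M. probX A \<omega> > 0 \<longrightarrow> probX A' \<omega> > 0 \<longrightarrow>
       cexp_on Z A \<omega> / probX A \<omega> = cexp_on Z' A' \<omega> / probX A' \<omega>)"
proof -
  have "(AE \<omega> in M. probX A \<omega> > 0 \<longrightarrow> probX A' \<omega> > 0 \<longrightarrow> cexpX Z A \<omega> = cexpX Z' A' \<omega>) \<longleftrightarrow>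
      (AE \<omega> in M. probX A \<omega> > 0 \<longrightarrow> probX A' \<omega> > 0 \<longrightarrow>
         cexp_on Z A \<omega> / probX A \<omega> = cexp_on Z' A' \<omega> / probX A' \<omega>)"
    if "integrable (uniform_measure M A) Z" "integrable (uniform_measure M A') Z'"
  proof (rule eventually_subst)
    show "AE \<omega> in M. (probX A \<omega> > 0 \<longrightarrow> probX A' \<omega> > 0 \<longrightarrow> cexpX Z A \<omega> = cexpX Z' A' \<omega>) \<longleftrightarrow>
        (probX A \<omega> > 0 \<longrightarrow> probX A' \<omega> > 0 \<longrightarrow>
           cexp_on Z A \<omega> / probX A \<omega> = cexp_on Z' A' \<omega> / probX A' \<omega>)"
      using cexp_on_eq[OF assms(1,2) that(1)] cexp_on_eq[OF assms(3,4) that(2)]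
      by eventually_elim auto
  qed
  then show ?thesis
    unfolding cexpX_eq_def by blast
qed

text \<open>The denominators depend only on the events, so it suffices to add the numerators
  \<open>cexp_on\<close>.\<close>

lemma cexpX_eq_add:
  assumes A: "A \<in> events" "prob A > 0" "A' \<in> events" "prob A' > 0"
    and Z: "cexpX_eq Z A Z' A'" and W: "cexpX_eq W A W' A'"
  shows "cexpX_eq (\<lambda>\<omega>. Z \<omega> + W \<omega>) A (\<lambda>\<omega>. Z' \<omega> + W' \<omega>) A'"
proof -
  have add: "AE \<omega> in M. cexp_on (\<lambda>\<omega>. V \<omega> + V' \<omega>) B \<omega> = cexp_on V B \<omega> + cexp_on V' B \<omega>"
    if B: "B \<in> events" "prob B > 0"
      and V: "integrable (uniform_measure M B) V" "integrable (uniform_measure M B) V'" for V V' B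
  proof -
    have [measurable]: "V \<in> borel_measurable M" "V' \<in> borel_measurable M"
      using borel_measurable_integrable[OF V(1)] borel_measurable_integrable[OF V(2)] by simp_all
    show ?thesis
      using V by (auto simp: distrib_left integrable_uniform_measure_iff[OF B]
          intro!: sigmaX.real_cond_exp_add)
  qed
  from Z W have i: "integrable (uniform_measure M A) Z" "integrable (uniform_measure M A') Z'"
      "integrable (uniform_measure M A) W" "integrable (uniform_measure M A') W'"
    by (simp_all add: cexpX_eq_def)
  have "AE \<omega> in M. probX A \<omega> > 0 \<longrightarrow> probX A' \<omega> > 0 \<longrightarrow>
      cexp_on (\<lambda>\<omega>. Z \<omega> + W \<omega>) A \<omega> / probX A \<omega> = cexp_on (\<lambda>\<omega>. Z' \<omega> + W' \<omega>) A' \<omega> / probX A' \<omega>"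
    using add[OF A(1,2) i(1,3)] add[OF A(3,4) i(2,4)]
      Z[unfolded cexpX_eq_iff[OF A], THEN conjunct2, THEN conjunct2]
      W[unfolded cexpX_eq_iff[OF A], THEN conjunct2, THEN conjunct2]
    by eventually_elim (simp add: add_divide_distrib)
  with i show ?thesis
    unfolding cexpX_eq_iff[OF A] by (auto intro: Bochner_Integration.integrable_add)
qed

lemma cexpX_eq_telescope:
  fixes V :: "nat \<Rightarrow> 'a \<Rightarrow> real"
  assumes A: "A \<in> events" "prob A > 0" "A' \<in> events" "prob A' > 0"
    and step: "\<And>s. b < s \<Longrightarrow> s \<le> t \<Longrightarrow>
      cexpX_eq (\<lambda>\<omega>. V s \<omega> - V (s - 1) \<omega>) A (\<lambda>\<omega>. V s \<omega> - V (s - 1) \<omega>) A'"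
    and "b < t"
  shows "cexpX_eq (\<lambda>\<omega>. V t \<omega> - V b \<omega>) A (\<lambda>\<omega>. V t \<omega> - V b \<omega>) A'"
proof -
  \<comment> \<open>The induction starts at \<open>Suc b\<close>, where the difference is a single
    increment and \<open>step\<close> applies as it stands.\<close>
  have "cexpX_eq (\<lambda>\<omega>. V s \<omega> - V b \<omega>) A (\<lambda>\<omega>. V s \<omega> - V b \<omega>) A'" if "Suc b \<le> s" "s \<le> t" for s
    using that
  proof (induction s rule: dec_induct)
    case base
    then show ?case using step[of "Suc b"] by simp
  next
    case (step s)
    then show ?case
      using cexpX_eq_add[OF A step.IH assms(5)[of "Suc s"]] by simp
  qed
  from this[of t] \<open>b < t\<close> show ?thesis by simp
qed

text \<open>Beyond integrability, the right-hand variable enters only through its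
  \<open>cexp_on\<close>. This is how observed outcomes take the place of untreated potential
  outcomes in the control group.\<close>

lemma cexpX_eq_replace:
  assumes A: "A \<in> events" "prob A > 0" "A' \<in> events" "prob A' > 0"
    and W: "cexpX_eq W A W' A'" and Z: "integrable (uniform_measure M A') Z"
    and eq: "AE \<omega> in M. cexp_on Z A' \<omega> = cexp_on W' A' \<omega>"
  shows "cexpX_eq W A Z A'"
proof -
  have "AE \<omega> in M. probX A \<omega> > 0 \<longrightarrow> probX A' \<omega> > 0 \<longrightarrow>
      cexp_on W A \<omega> / probX A \<omega> = cexp_on Z A' \<omega> / probX A' \<omega>"
    using eq W[unfolded cexpX_eq_iff[OF A], THEN conjunct2, THEN conjunct2]
    by eventually_elim simp
  with W Z show ?thesis
    unfolding cexpX_eq_iff[OF A] by blast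
qed

lemma cexpX_eq_same_eventD:
  assumes A: "A \<in> events" "prob A > 0" and eq: "cexpX_eq Z A W A"
  shows "AE \<omega> in M. cexp_on Z A \<omega> = cexp_on W A \<omega>"
  using eq[unfolded cexpX_eq_def, THEN conjunct2, THEN conjunct2] probX_nonneg[OF A(1)]
    cexp_on_eq[OF A eq[unfolded cexpX_eq_def, THEN conjunct1]]
    cexp_on_eq[OF A eq[unfolded cexpX_eq_def, THEN conjunct2, THEN conjunct1]]
  by eventually_elim (auto simp: less_le)

subsection \<open>Reweighting by the odds of the propensity score\<close>

text \<open>Bayes' formula gives P(A | X) = P(U | X) p, and P(U | X) = P(A | X) + P(B | X) by
  disjointness, so P(B | X) = P(U | X) (1 - p). If \<open>B\<close> were null, the resulting
  identity for the odds would make \<open>A\<close> null as well. \<open>U\<close> agrees with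
  \<open>A \<union> B\<close> only almost surely, which lets the never-treated units stand for those
  with \<open>D T = 0\<close>.\<close>

lemma propensity_odds:
  assumes [measurable]: "A \<in> events" "B \<in> events" "U \<in> events" and "A \<inter> B = {}"
    and U: "AE \<omega> in M. \<omega> \<in> U \<longleftrightarrow> \<omega> \<in> A \<union> B" and A: "prob A > 0"
    and \<epsilon>: "\<epsilon> > 0" "AE \<omega> in M. cexpX (indicator A) U \<omega> < 1 - \<epsilon>"
  defines "p \<equiv> cexpX (indicator A) U"
  defines "r \<equiv> \<lambda>\<omega>. p \<omega> / (1 - p \<omega>)"
  shows "AE \<omega> in M. 0 \<le> r \<omega> \<and> r \<omega> \<le> 1 / \<epsilon>"
    and "AE \<omega> in M. r \<omega> * probX B \<omega> = probX A \<omega>"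
    and "prob B > 0"
proof -
  have AU: "AE \<omega> in M. \<omega> \<in> A \<longrightarrow> \<omega> \<in> U"
    using U by eventually_elim simp
  then have "prob A \<le> prob U"
    by (intro finite_measure_mono_AE) auto
  with A have PU: "prob U > 0" by simp
  have "integrable (uniform_measure M U) (indicat_real A)"
    unfolding integrable_uniform_measure_iff[OF assms(3) PU borel_measurable_indicator[OF assms(1)]]
    by (simp add: integrable_indicator_event flip: indicator_inter_arith)
  then have "AE \<omega> in M. cexp_on (indicator A) U \<omega> = probX U \<omega> * p \<omega>"
    unfolding p_def by (rule cexp_on_eq[OF assms(3) PU])
  moreover have "AE \<omega> in M. cexp_on (indicator A) U \<omega> = probX A \<omega>"
    unfolding probX_def
    by (rule sigmaX.real_cond_exp_cong) (use AU in \<open>auto split: split_indicator\<close>)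
  ultimately have 1: "AE \<omega> in M. probX A \<omega> = probX U \<omega> * p \<omega>"
    by eventually_elim simp
  have "AE \<omega> in M. probX U \<omega> = real_cond_exp M sigmaX (\<lambda>\<omega>. indicator A \<omega> + indicator B \<omega>) \<omega>"
    unfolding probX_def
  proof (rule sigmaX.real_cond_exp_cong)
    show "AE \<omega> in M. indicat_real U \<omega> = indicator A \<omega> + indicator B \<omega>"
      using U by eventually_elim (use \<open>A \<inter> B = {}\<close> in \<open>auto split: split_indicator\<close>)
  qed auto
  moreover have "AE \<omega> in M. real_cond_exp M sigmaX (\<lambda>\<omega>. indicator A \<omega> + indicator B \<omega>) \<omega> =
      probX A \<omega> + probX B \<omega>"
    unfolding probX_def by (rule sigmaX.real_cond_exp_add) (rule integrable_indicator_event, fact)+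
  ultimately have 2: "AE \<omega> in M. probX U \<omega> = probX A \<omega> + probX B \<omega>"
    by eventually_elim simp
  \<comment> \<open>Where P(U | X) is positive the sign follows from the product formula; elsewhere
    \<open>p\<close> has its default value 0.\<close>
  have p0: "AE \<omega> in M. 0 \<le> p \<omega>"
    using 1 probX_nonneg[OF assms(1)]
    by eventually_elim (auto simp: p_def cexpX_def zero_le_mult_iff)
  show r: "AE \<omega> in M. 0 \<le> r \<omega> \<and> r \<omega> \<le> 1 / \<epsilon>"
    using p0 \<epsilon>(2) unfolding p_def[symmetric]
  proof eventually_elim
    case (elim \<omega>)
    \<comment> \<open>Overlap bounds the numerator by 1 from above and the denominator by \<epsilon>
      from below.\<close>
    have "p \<omega> / (1 - p \<omega>) \<le> 1 / \<epsilon>"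
      using elim \<epsilon>(1) by (intro frac_le) auto
    with elim \<epsilon>(1) show ?case by (simp add: r_def)
  qed
  show rB: "AE \<omega> in M. r \<omega> * probX B \<omega> = probX A \<omega>"
    using 1 2 \<epsilon>(2) unfolding p_def[symmetric]
  proof eventually_elim
    case (elim \<omega>)
    then have "probX B \<omega> = probX U \<omega> - probX U \<omega> * p \<omega>"
      by linarith
    then have "probX B \<omega> = probX U \<omega> * (1 - p \<omega>)"
      by (simp add: right_diff_distrib)
    then have "r \<omega> * probX B \<omega> = probX U \<omega> * p \<omega>"
      using elim(3) \<epsilon>(1) by (simp add: r_def)
    with elim(1) show ?case by simp
  qed
  show "prob B > 0"
  proof (rule ccontr)
    assume "\<not> prob B > 0"
    then have "prob B = 0"
      by (simp add: measure_le_0_iff not_less)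
    then have "AE \<omega> in M. \<omega> \<notin> B"
      using prob_eq_0[OF assms(2)] by blast
    then have "AE \<omega> in M. indicat_real B \<omega> = 0"
      by eventually_elim simp
    then have "AE \<omega> in M. probX B \<omega> = real_cond_exp M sigmaX (\<lambda>_. 0) \<omega>"
      unfolding probX_def by (rule sigmaX.real_cond_exp_cong) simp_all
    moreover have "AE \<omega> in M. real_cond_exp M sigmaX (\<lambda>_. 0) \<omega> = (0::real)"
      by (rule sigmaX.real_cond_exp_F_meas) auto
    ultimately have "AE \<omega> in M. probX A \<omega> = 0"
      using rB by eventually_elim simp
    then have "(\<integral>\<omega>. probX A \<omega> \<partial>M) = 0"
      by (intro integral_eq_zero_AE)
    with A show False
      by (simp add: integral_probX)
  qed
qed

text \<open>Conditioning on X turns E[r 1_B Z] into E[r P(B | X) E[Z | X, B]], the odds identity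
  replaces r P(B | X) by P(A | X), and this factor is exchanged for 1_A because the rest depends on
  X alone. The bound on \<open>r\<close> provides integrability.\<close>

lemma reweighting:
  assumes [measurable]: "A \<in> events" "B \<in> events" "r \<in> borel_measurable sigmaX"
    and B: "prob B > 0"
    and r: "AE \<omega> in M. 0 \<le> r \<omega> \<and> r \<omega> \<le> K" "AE \<omega> in M. r \<omega> * probX B \<omega> = probX A \<omega>"
    and Z: "integrable (uniform_measure M B) Z"
    and m: "integrable M (\<lambda>\<omega>. indicator A \<omega> * cexpX Z B \<omega>)"
  shows "integrable M (\<lambda>\<omega>. r \<omega> * indicator B \<omega> * Z \<omega>)"
    and "(\<integral>\<omega>. r \<omega> * indicator B \<omega> * Z \<omega> \<partial>M) = (\<integral>\<omega>. indicator A \<omega> * cexpX Z B \<omega> \<partial>M)"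
proof -
  note [measurable] = borel_measurable_sigmaX_M[OF assms(3)]
  have [measurable]: "Z \<in> borel_measurable M"
    using borel_measurable_integrable[OF Z] by simp
  have "integrable M (\<lambda>\<omega>. indicator B \<omega> * Z \<omega>)"
    using Z by (simp add: integrable_uniform_measure_iff[OF assms(2) B])
  then have i: "integrable M (\<lambda>\<omega>. r \<omega> * (indicator B \<omega> * Z \<omega>))"
    by (rule integrable_mult_AE_bounded) (use r in auto)
  then show "integrable M (\<lambda>\<omega>. r \<omega> * indicator B \<omega> * Z \<omega>)"
    by (simp add: mult.assoc)
  have "(\<integral>\<omega>. r \<omega> * indicator B \<omega> * Z \<omega> \<partial>M) = (\<integral>\<omega>. r \<omega> * cexp_on Z B \<omega> \<partial>M)"
    using i by (subst sigmaX.real_cond_exp_intg(2)) (auto simp: mult.assoc)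
  also have "\<dots> = (\<integral>\<omega>. cexpX Z B \<omega> * probX A \<omega> \<partial>M)"
  proof (rule integral_cong_AE)
    show "AE \<omega> in M. r \<omega> * cexp_on Z B \<omega> = cexpX Z B \<omega> * probX A \<omega>"
      using cexp_on_eq[OF assms(2) B Z] r(2) by eventually_elim (metis mult.assoc mult.commute)
  qed (auto intro: borel_measurable_sigmaX_M)
  also have "\<dots> = (\<integral>\<omega>. indicator A \<omega> * cexpX Z B \<omega> \<partial>M)"
    using m by (subst integral_mult_probX) (auto simp: mult.commute)
  finally show "(\<integral>\<omega>. r \<omega> * indicator B \<omega> * Z \<omega> \<partial>M) = (\<integral>\<omega>. indicator A \<omega> * cexpX Z B \<omega> \<partial>M)" .
qed

text \<open>The tower property, written under \<open>M\<close>: the indicator of \<open>A\<close> is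
  exchanged for P(A | X), and Bayes' formula turns the product into E[1_A W | X].\<close>

lemma integral_cexpX:
  assumes [measurable]: "A \<in> events" and A: "prob A > 0" and W: "integrable (uniform_measure M A) W"
  shows "integrable M (\<lambda>\<omega>. indicator A \<omega> * cexpX W A \<omega>)"
    and "(\<integral>\<omega>. indicator A \<omega> * cexpX W A \<omega> \<partial>M) = (\<integral>\<omega>. indicator A \<omega> * W \<omega> \<partial>M)"
proof -
  interpret U: prob_space "uniform_measure M A"
    using A by (intro prob_space_uniform_measure) (auto simp: emeasure_eq_measure)
  interpret U: finite_measure_subalgebra "uniform_measure M A" sigmaX
    using subalgebra_sigmaX by unfold_locales (simp add: subalgebra_def)
  have [measurable]: "W \<in> borel_measurable M"
    using borel_measurable_integrable[OF W] by simp
  have [measurable]: "real_cond_exp (uniform_measure M A) sigmaX W \<in> borel_measurable M"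
    by (rule borel_measurable_sigmaX_M) simp
  have "integrable (uniform_measure M A) (real_cond_exp (uniform_measure M A) sigmaX W)"
    using W by (rule U.real_cond_exp_int)
  then have i: "integrable M (\<lambda>\<omega>. indicator A \<omega> * real_cond_exp (uniform_measure M A) sigmaX W \<omega>)"
    using A by (subst (asm) integrable_uniform_measure_iff) auto
  \<comment> \<open>The default value 0 can only lower the absolute value.\<close>
  show i': "integrable M (\<lambda>\<omega>. indicator A \<omega> * cexpX W A \<omega>)"
    by (rule Bochner_Integration.integrable_bound[OF i])
       (auto simp: cexpX_def split: split_indicator)
  have "(\<integral>\<omega>. indicator A \<omega> * cexpX W A \<omega> \<partial>M) = (\<integral>\<omega>. cexpX W A \<omega> * probX A \<omega> \<partial>M)"
    using i' by (subst integral_mult_probX) (auto simp: mult.commute)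
  also have "\<dots> = (\<integral>\<omega>. cexp_on W A \<omega> \<partial>M)"
    using cexp_on_eq[OF assms(1-3)]
    by (intro integral_cong_AE) (auto intro: borel_measurable_sigmaX_M simp: mult.commute)
  also have "\<dots> = (\<integral>\<omega>. indicator A \<omega> * W \<omega> \<partial>M)"
    using W A by (intro sigmaX.real_cond_exp_int) (simp add: integrable_uniform_measure_iff)
  finally show "(\<integral>\<omega>. indicator A \<omega> * cexpX W A \<omega> \<partial>M) = (\<integral>\<omega>. indicator A \<omega> * W \<omega> \<partial>M)" .
qed

text \<open>The regression \<open>m\<close> equals E[W | X, A] on \<open>A\<close>, so E[1_A m] =
  E[1_A W]. Reweighting gives the same value to E[r 1_B Z] and to E[r 1_B m], and r 1_B has
  expectation P(A). So the control term of the first estimand and the regression term of the second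
  both contribute E[1_A W] / P(A), and in the third the two control terms cancel.\<close>

lemma weighted_estimands:
  assumes [measurable]: "A \<in> events" "B \<in> events" "r \<in> borel_measurable sigmaX"
    and A: "prob A > 0" and B: "prob B > 0"
    and r: "AE \<omega> in M. 0 \<le> r \<omega> \<and> r \<omega> \<le> K" "AE \<omega> in M. r \<omega> * probX B \<omega> = probX A \<omega>"
    and eq: "cexpX_eq W A Z B" and Z: "integrable (uniform_measure M A) Z"
  defines "m \<equiv> cexpX Z B"
  defines "w1 \<equiv> \<lambda>\<omega>. indicator A \<omega> / prob A"
  defines "w0 \<equiv> \<lambda>\<omega>. r \<omega> * indicator B \<omega> / expectation (\<lambda>\<omega>. r \<omega> * indicator B \<omega>)"
  defines "att \<equiv> (\<integral>\<omega>. indicator A \<omega> * (Z \<omega> - W \<omega>) \<partial>M) / prob A"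
  shows "expectation (\<lambda>\<omega>. (w1 \<omega> - w0 \<omega>) * Z \<omega>) = att"
    and "expectation (\<lambda>\<omega>. w1 \<omega> * (Z \<omega> - m \<omega>)) = att"
    and "expectation (\<lambda>\<omega>. (w1 \<omega> - w0 \<omega>) * (Z \<omega> - m \<omega>)) = att"
proof -
  note [measurable] = borel_measurable_sigmaX_M[OF assms(3)]
  from eq have W: "integrable (uniform_measure M A) W" and ZB: "integrable (uniform_measure M B) Z"
    by (simp_all add: cexpX_eq_def)
  have [measurable]: "W \<in> borel_measurable M" "Z \<in> borel_measurable M"
    using borel_measurable_integrable[OF W] borel_measurable_integrable[OF Z] by simp_all
  have [measurable]: "m \<in> borel_measurable M"
    by (simp add: m_def)
  have iW: "integrable M (\<lambda>\<omega>. indicator A \<omega> * W \<omega>)"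
    and iZ: "integrable M (\<lambda>\<omega>. indicator A \<omega> * Z \<omega>)"
    using W Z A by (simp_all add: integrable_uniform_measure_iff)
  \<comment> \<open>On \<open>A\<close> almost surely P(A | X) > 0, and then r P(B | X) = P(A | X)
    forces P(B | X) > 0. So both sides of \<open>eq\<close> are defined at almost every point of
    \<open>A\<close>.\<close>
  have "AE \<omega> in M. indicator A \<omega> * m \<omega> = indicator A \<omega> * cexpX W A \<omega>"
    using AE_probX_pos[OF assms(1)] r probX_nonneg[OF assms(2)] eq[unfolded cexpX_eq_def, THEN conjunct2, THEN conjunct2]
  proof eventually_elim
    case (elim \<omega>)
    show ?case
    proof (cases "\<omega> \<in> A")
      case True
      with elim have "probX A \<omega> > 0" "probX B \<omega> > 0"
        by (auto simp: less_le)
      with elim True show ?thesis by (simp add: m_def)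
    qed simp
  qed
  note m_eq = this
  have im: "integrable M (\<lambda>\<omega>. indicator A \<omega> * m \<omega>)"
    using integrable_cong_AE[OF _ _ m_eq] integral_cexpX(1)[OF assms(1) A W] by simp
  have Em: "(\<integral>\<omega>. indicator A \<omega> * m \<omega> \<partial>M) = (\<integral>\<omega>. indicator A \<omega> * W \<omega> \<partial>M)"
    using integral_cong_AE[OF _ _ m_eq] integral_cexpX(2)[OF assms(1) A W] by simp
  \<comment> \<open>The normalising constant of the control weight is P(A), so both weights have the
    same denominator.\<close>
  have "(\<integral>\<omega>. r \<omega> * indicator B \<omega> \<partial>M) = (\<integral>\<omega>. r \<omega> * probX B \<omega> \<partial>M)"
    using integrable_mult_AE_bounded[of M "indicator B" r K] r(1)
    by (subst integral_mult_probX) (simp_all add: integrable_indicator_event)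
  also have "\<dots> = (\<integral>\<omega>. probX A \<omega> \<partial>M)"
    using r(2) by (intro integral_cong_AE) auto
  also have "\<dots> = prob A"
    by (simp add: integral_probX)
  finally have w0: "w0 = (\<lambda>\<omega>. r \<omega> * indicator B \<omega> / prob A)"
    by (simp add: w0_def)
  note rZ = reweighting[OF assms(1-3) B r ZB im[unfolded m_def], folded m_def]
  have irm: "integrable M (\<lambda>\<omega>. r \<omega> * indicator B \<omega> * m \<omega>)"
    using integrable_mult_AE_bounded[OF integral_cexpX(1)[OF assms(2) B ZB], of r K] r(1)
    by (simp add: m_def mult.assoc)
  have Erm: "(\<integral>\<omega>. r \<omega> * indicator B \<omega> * m \<omega> \<partial>M) = (\<integral>\<omega>. indicator A \<omega> * W \<omega> \<partial>M)"
  proof -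
    \<comment> \<open>Both \<open>r\<close> and \<open>m\<close> depend on X alone, so 1_B may be
      exchanged for P(B | X), and later P(A | X) for 1_A.\<close>
    have "(\<integral>\<omega>. r \<omega> * indicator B \<omega> * m \<omega> \<partial>M) = (\<integral>\<omega>. (r \<omega> * m \<omega>) * probX B \<omega> \<partial>M)"
      using irm by (subst integral_mult_probX) (auto simp: ac_simps m_def)
    also have "\<dots> = (\<integral>\<omega>. m \<omega> * probX A \<omega> \<partial>M)"
    proof (rule integral_cong_AE)
      show "AE \<omega> in M. (r \<omega> * m \<omega>) * probX B \<omega> = m \<omega> * probX A \<omega>"
        using r(2) by eventually_elim (simp add: ac_simps)
    qed auto
    also have "\<dots> = (\<integral>\<omega>. indicator A \<omega> * m \<omega> \<partial>M)"
      using im by (subst integral_mult_probX) (auto simp: mult.commute m_def)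
    finally show ?thesis by (simp add: Em)
  qed
  have att: "att = ((\<integral>\<omega>. indicator A \<omega> * Z \<omega> \<partial>M) - (\<integral>\<omega>. indicator A \<omega> * W \<omega> \<partial>M)) / prob A"
    using iZ iW by (simp add: att_def right_diff_distrib)
  \<comment> \<open>One identity serves all three estimands: \<open>y = 0\<close> removes the
    regression, \<open>b = 0\<close> removes the control weight.\<close>
  have expand: "(a / c - b / c) * (z - y) = (a * z - a * y - (b * z - b * y)) / c" for a b c z y :: real
    by (cases "c = 0") (simp_all add: field_simps)
  have e1: "(w1 \<omega> - w0 \<omega>) * Z \<omega> =
      (indicator A \<omega> * Z \<omega> - r \<omega> * indicator B \<omega> * Z \<omega>) / prob A" for \<omega>
    using expand[of _ _ _ _ 0] by (simp add: w1_def w0)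
  show "expectation (\<lambda>\<omega>. (w1 \<omega> - w0 \<omega>) * Z \<omega>) = att"
    unfolding e1 using iZ rZ Em by (simp add: att)
  have e2: "w1 \<omega> * (Z \<omega> - m \<omega>) = (indicator A \<omega> * Z \<omega> - indicator A \<omega> * m \<omega>) / prob A" for \<omega>
    using expand[of _ _ 0] by (simp add: w1_def)
  show "expectation (\<lambda>\<omega>. w1 \<omega> * (Z \<omega> - m \<omega>)) = att"
    unfolding e2 using iZ im Em by (simp add: att)
  have e3: "(w1 \<omega> - w0 \<omega>) * (Z \<omega> - m \<omega>) = (indicator A \<omega> * Z \<omega> - indicator A \<omega> * m \<omega>
      - (r \<omega> * indicator B \<omega> * Z \<omega> - r \<omega> * indicator B \<omega> * m \<omega>)) / prob A" for \<omega>
    unfolding w1_def w0 by (rule expand)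
  show "expectation (\<lambda>\<omega>. (w1 \<omega> - w0 \<omega>) * (Z \<omega> - m \<omega>)) = att"
    unfolding e3 using iZ im irm rZ Em Erm by (simp add: att)
qed

subsection \<open>The first treatment period\<close>

lemma G_le: "t \<in> {1..T} \<Longrightarrow> D t \<omega> = 1 \<Longrightarrow> G \<omega> \<le> enat t"
  unfolding G_def by (intro Inf_lower) auto

lemma G_eq_infinity_iff: "G \<omega> = \<infinity> \<longleftrightarrow> (\<forall>t\<in>{1..T}. D t \<omega> \<noteq> 1)"
proof
  assume inf: "G \<omega> = \<infinity>"
  show "\<forall>t\<in>{1..T}. D t \<omega> \<noteq> 1"
  proof (intro ballI notI)
    fix t assume "t \<in> {1..T}" "D t \<omega> = 1"
    from G_le[OF this] inf show False by simp
  qed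
next
  assume "\<forall>t\<in>{1..T}. D t \<omega> \<noteq> 1"
  then have "enat ` {t \<in> {1..T}. D t \<omega> = 1} = {}" by blast
  then show "G \<omega> = \<infinity>"
    by (simp only: G_def Inf_enat_def simp_thms if_True)
qed

text \<open>The infimum of a nonempty set of type \<open>enat\<close> is its least element and is
  therefore attained.\<close>

lemma G_eq_enatD:
  assumes g: "G \<omega> = enat g"
  shows "g \<in> {1..T}" "D g \<omega> = 1"
proof -
  define S where "S = enat ` {t \<in> {1..T}. D t \<omega> = 1}"
  have "\<not> (\<forall>t\<in>{1..T}. D t \<omega> \<noteq> 1)"
    using g by (simp only: G_eq_infinity_iff[symmetric]) simp
  then obtain x where x: "x \<in> S"
    unfolding S_def by blast
  then have "G \<omega> = (LEAST x. x \<in> S)"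
    unfolding G_def S_def[symmetric] Inf_enat_def by (simp only: if_False emptyE split: if_split) blast
  moreover have "(LEAST x. x \<in> S) \<in> S"
    using x by (rule LeastI)
  ultimately have "enat g \<in> S"
    using g by simp
  then show "g \<in> {1..T}" "D g \<omega> = 1"
    unfolding S_def by blast+
qed

text \<open>This form involves finitely many indicators \<open>D t\<close> only, from which
  measurability of the group events follows.\<close>

lemma G_eq_enat_iff:
  "G \<omega> = enat g \<longleftrightarrow> g \<in> {1..T} \<and> D g \<omega> = 1 \<and> (\<forall>t\<in>{1..<g}. D t \<omega> \<noteq> 1)"
proof
  assume g: "G \<omega> = enat g"
  have "D t \<omega> \<noteq> 1" if t: "t \<in> {1..<g}" for t
  proof
    assume "D t \<omega> = 1"
    moreover have "t \<in> {1..T}"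
      using t G_eq_enatD(1)[OF g] by simp
    ultimately have "G \<omega> \<le> enat t"
      using G_le by blast
    with g t show False by simp
  qed
  with G_eq_enatD[OF g] show "g \<in> {1..T} \<and> D g \<omega> = 1 \<and> (\<forall>t\<in>{1..<g}. D t \<omega> \<noteq> 1)"
    by blast
next
  assume *: "g \<in> {1..T} \<and> D g \<omega> = 1 \<and> (\<forall>t\<in>{1..<g}. D t \<omega> \<noteq> 1)"
  show "G \<omega> = enat g"
  proof (rule antisym)
    show "G \<omega> \<le> enat g"
      using * G_le by blast
    have "g \<le> t" if "t \<in> {1..T}" "D t \<omega> = 1" for t
      using that * by (meson atLeastAtMost_iff atLeastLessThan_iff not_le)
    then show "enat g \<le> G \<omega>"
      unfolding G_def by (intro Inf_greatest) auto
  qed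
qed

section \<open>Group events and observed outcomes\<close>

lemma treated_in_eq: "treated_in g = {\<omega> \<in> space M. G \<omega> = enat g}"
  by (auto simp: treated_in_def Gind_def)

lemma never_treated_eq: "never_treated = {\<omega> \<in> space M. G \<omega> = \<infinity>}"
  by (auto simp: never_treated_def C_def)

lemma not_yet_treated_eq: "not_yet_treated g s = {\<omega> \<in> space M. D s \<omega> = 0} - treated_in g"
  by (auto simp: not_yet_treated_def treated_in_def Gind_def)

lemma treated_in_events [measurable]: "treated_in g \<in> events"
proof (cases "g \<in> {1..T}")
  case True
  then have D: "D t \<in> borel_measurable M" if "t \<in> {1..g}" for t
    using that by (intro D_measurable) auto
  have [measurable]: "D g \<in> borel_measurable M"
    using D[of g] True by auto
  have [measurable]: "Measurable.pred M (\<lambda>\<omega>. \<forall>t\<in>{1..<g}. D t \<omega> \<noteq> 1)"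
  proof (rule pred_intros_finite)
    fix t assume "t \<in> {1..<g}"
    then have [measurable]: "D t \<in> borel_measurable M"
      by (intro D) auto
    show "Measurable.pred M (\<lambda>\<omega>. D t \<omega> \<noteq> 1)" by measurable
  qed simp
  show ?thesis
    unfolding treated_in_eq G_eq_enat_iff by measurable
next
  case False
  then have "treated_in g = {}"
    unfolding treated_in_eq G_eq_enat_iff by blast
  then show ?thesis by simp
qed

lemma never_treated_events [measurable]: "never_treated \<in> events"
proof -
  have [measurable]: "Measurable.pred M (\<lambda>\<omega>. \<forall>t\<in>{1..T}. D t \<omega> \<noteq> 1)"
  proof (rule pred_intros_finite)
    fix t assume "t \<in> {1..T}"
    then have [measurable]: "D t \<in> borel_measurable M"
      by (rule D_measurable)
    show "Measurable.pred M (\<lambda>\<omega>. D t \<omega> \<noteq> 1)" by measurable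
  qed simp
  show ?thesis
    unfolding never_treated_eq G_eq_infinity_iff by measurable
qed

lemma not_yet_treated_events: "s \<in> {1..T} \<Longrightarrow> not_yet_treated g s \<in> events"
  using D_measurable[of s] unfolding not_yet_treated_eq by measurable

lemma Gind_eq_indicator: "\<omega> \<in> space M \<Longrightarrow> Gind g \<omega> = indicator (treated_in g) \<omega>"
  by (auto simp: Gind_def treated_in_eq split: split_indicator)

lemma Gind_measurable [measurable]: "Gind g \<in> borel_measurable M"
proof -
  have "indicat_real (treated_in g) \<in> borel_measurable M \<longleftrightarrow> Gind g \<in> borel_measurable M"
    by (rule measurable_cong) (simp add: Gind_eq_indicator)
  then show ?thesis by simp
qed

lemma expectation_Gind: "expectation (Gind g) = prob (treated_in g)"
proof -
  have "expectation (Gind g) = expectation (indicator (treated_in g))"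
    by (rule Bochner_Integration.integral_cong) (simp_all add: Gind_eq_indicator)
  then show ?thesis by simp
qed

lemma Yobs_measurable: "t \<in> {1..T} \<Longrightarrow> Yobs t \<in> borel_measurable M"
  unfolding Yobs_def[abs_def]
  by (intro borel_measurable_add borel_measurable_sum borel_measurable_times
      borel_measurable_diff Y_measurable) auto

lemma Yobs_treated: "g \<in> {2..T} \<Longrightarrow> G \<omega> = enat g \<Longrightarrow> Yobs t \<omega> = Y t g \<omega>"
proof -
  assume g: "g \<in> {2..T}" "G \<omega> = enat g"
  have "(\<Sum>h = 2..T. (Y t h \<omega> - Y t 0 \<omega>) * Gind h \<omega>) =
      (\<Sum>h = 2..T. if g = h then Y t h \<omega> - Y t 0 \<omega> else 0)"
    using g by (intro sum.cong) (auto simp: Gind_def)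
  also have "\<dots> = Y t g \<omega> - Y t 0 \<omega>"
    using g by simp
  finally show ?thesis by (simp add: Yobs_def)
qed

lemma Yobs_never_treated: "G \<omega> = \<infinity> \<Longrightarrow> Yobs t \<omega> = Y t 0 \<omega>"
  by (simp add: Yobs_def Gind_def)

text \<open>Almost surely treatment persists once it has begun, so the untreated periods are exactly
  those before the first treatment.\<close>

lemma irreversibility_iff_less_G:
  assumes irreversibility
  shows "AE \<omega> in M. \<forall>s\<in>{1..T}. D s \<omega> = 0 \<longleftrightarrow> enat s < G \<omega>"
proof -
  have "AE \<omega> in M. \<forall>t\<in>{2..T}. D (t - 1) \<omega> = 1 \<longrightarrow> D t \<omega> = 1"
    using assms by (intro AE_finite_allI) (auto simp: irreversibility_def)
  with AE_space show ?thesis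
  proof eventually_elim
    case (elim \<omega>)
    show ?case
    proof (intro ballI iffI)
      fix s assume s: "s \<in> {1..T}" and D: "D s \<omega> = 0"
      show "enat s < G \<omega>"
      proof (rule ccontr)
        assume "\<not> enat s < G \<omega>"
        then obtain g where g: "G \<omega> = enat g" "g \<le> s"
          by (cases "G \<omega>") auto
        \<comment> \<open>Induction upwards from the first treated period. The guard
          \<open>s \<le> T\<close> is there because irreversibility speaks of periods up to
          \<open>T\<close> only.\<close>
        from \<open>g \<le> s\<close> have "s \<le> T \<longrightarrow> D s \<omega> = 1"
        proof (induction s rule: dec_induct)
          case base
          then show ?case using G_eq_enatD[OF g(1)] by simp
        next
          case (step n)
          then show ?case
            using elim(2)[rule_format, of "Suc n"] G_eq_enatD(1)[OF g(1)] by auto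
        qed
        with s D show False by simp
      qed
    next
      fix s assume s: "s \<in> {1..T}" and G: "enat s < G \<omega>"
      have "D s \<omega> \<noteq> 1"
      proof
        assume "D s \<omega> = 1"
        from G_le[OF s this] G show False by simp
      qed
      with D_binary[OF s elim(1)] show "D s \<omega> = 0" by blast
    qed
  qed
qed

text \<open>Finiteness makes \<open>Max\<close> in the definition of \<open>gbar\<close> a genuine
  maximum.\<close>

lemma finite_suppG: "finite suppG"
proof (rule finite_subset)
  show "suppG \<subseteq> insert \<infinity> (enat ` {1..T})"
  proof
    fix x assume "x \<in> suppG"
    then have "prob {\<omega> \<in> space M. G \<omega> = x} \<noteq> 0"
      by (simp add: suppG_def)
    then have "{\<omega> \<in> space M. G \<omega> = x} \<noteq> {}"
      by (metis measure_empty)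
    then obtain \<omega> where \<omega>: "G \<omega> = x" by blast
    show "x \<in> insert \<infinity> (enat ` {1..T})"
    proof (cases x)
      case (enat h)
      with G_eq_enatD(1)[of \<omega> h] \<omega> show ?thesis by simp
    qed simp
  qed
qed simp

lemma gbar_eq_infinity: "prob never_treated > 0 \<Longrightarrow> gbar = \<infinity>"
  unfolding gbar_def using finite_suppG
  by (intro Max_eqI) (auto simp: suppG_def never_treated_eq)

lemma groups_prob_pos: "g \<in> groups \<Longrightarrow> prob (treated_in g) > 0"
  by (simp add: groups_def suppG_def treated_in_eq)

text \<open>With never-treated units \<open>gbar\<close> is infinite, so removing it from the
  support costs no finite group. Later treated groups are thereby seen to be subject to limited
  anticipation.\<close>

lemma mem_groups_iff:
  "prob never_treated > 0 \<Longrightarrow> g \<in> groups \<longleftrightarrow> prob (treated_in g) > 0"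
  by (simp add: groups_def suppG_def treated_in_eq gbar_eq_infinity)

lemma pscore_event_eq:
  "s \<in> {1..T} \<Longrightarrow> {\<omega> \<in> space M. Gind g \<omega> + (1 - D s \<omega>) * (1 - Gind g \<omega>) = 1} =
    treated_in g \<union> not_yet_treated g s"
  using D_binary[of s] by (auto simp: not_yet_treated_eq treated_in_eq Gind_def)

text \<open>Finite values of \<open>G\<close> are at most \<open>T\<close>, so being untreated in
  period \<open>T\<close> means never being treated. This identifies the control group behind
  \<open>pscore g T\<close>.\<close>

lemma never_treated_AE_eq:
  assumes irreversibility
  shows "AE \<omega> in M. \<omega> \<in> not_yet_treated g T \<longleftrightarrow> \<omega> \<in> never_treated"
  using irreversibility_iff_less_G[OF assms] AE_space
proof eventually_elim
  case (elim \<omega>)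
  have "D T \<omega> = 0 \<longleftrightarrow> enat T < G \<omega>"
    using elim(1) T_ge_2 by auto
  also have "\<dots> \<longleftrightarrow> G \<omega> = \<infinity>"
  proof (cases "G \<omega>")
    case (enat h)
    then have "h \<le> T"
      using G_eq_enatD(1) by auto
    with enat show ?thesis by simp
  qed simp
  finally show ?case
    using elim(2) by (cases "G \<omega> = \<infinity>") (simp_all add: never_treated_eq not_yet_treated_eq treated_in_eq)
qed

lemma limited_anticipation_cexp_on:
  assumes "limited_anticipation \<delta>" "g \<in> groups" "t \<in> {1..T}" "t + \<delta> < g"
  shows "integrable (uniform_measure M (treated_in g)) (Y t g)"
    and "integrable (uniform_measure M (treated_in g)) (Y t 0)"
    and "AE \<omega> in M. cexp_on (Y t g) (treated_in g) \<omega> = cexp_on (Y t 0) (treated_in g) \<omega>"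
proof -
  have eq: "cexpX_eq (Y t g) (treated_in g) (Y t 0) (treated_in g)"
    using assms by (auto simp: limited_anticipation_def)
  then show "integrable (uniform_measure M (treated_in g)) (Y t g)"
    and "integrable (uniform_measure M (treated_in g)) (Y t 0)"
    by (simp_all add: cexpX_eq_def)
  show "AE \<omega> in M. cexp_on (Y t g) (treated_in g) \<omega> = cexp_on (Y t 0) (treated_in g) \<omega>"
    using eq groups_prob_pos[OF assms(2)] by (intro cexpX_eq_same_eventD) auto
qed

subsection \<open>Observed trends\<close>

text \<open>In group \<open>g\<close> the observed change is the effect in period \<open>t\<close>,
  plus the untreated change, minus the effect in period \<open>b\<close>. The last effect has mean
  zero in the group by limited anticipation, since \<open>b + \<delta> < g\<close>.\<close>

lemma observed_trend_treated:
  assumes la: "limited_anticipation \<delta>" and g: "g \<in> groups" "g \<in> {2..T}"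
    and t: "t \<in> {1..T}" and b: "b \<in> {1..T}" "b + \<delta> < g"
    and att: "ATT_exists g t"
    and W: "integrable (uniform_measure M (treated_in g)) (\<lambda>\<omega>. Y t 0 \<omega> - Y b 0 \<omega>)"
  shows "integrable (uniform_measure M (treated_in g)) (\<lambda>\<omega>. Yobs t \<omega> - Yobs b \<omega>)"
    and "(\<integral>\<omega>. indicator (treated_in g) \<omega> *
      ((Yobs t \<omega> - Yobs b \<omega>) - (Y t 0 \<omega> - Y b 0 \<omega>)) \<partial>M) / prob (treated_in g) = ATT g t"
proof -
  let ?I = "indicat_real (treated_in g)"
  note A = treated_in_events[of g] groups_prob_pos[OF g(1)]
  note lab = limited_anticipation_cexp_on[OF la g(1) b]
  have [measurable]: "Y t g \<in> borel_measurable M" "Y b g \<in> borel_measurable M"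
      "Y t 0 \<in> borel_measurable M" "Y b 0 \<in> borel_measurable M"
      "Yobs t \<in> borel_measurable M" "Yobs b \<in> borel_measurable M"
    using g(2) t b by (auto intro!: Y_measurable Yobs_measurable)
  have i: "integrable M (\<lambda>\<omega>. ?I \<omega> * (Y t g \<omega> - Y t 0 \<omega>))"
      "integrable M (\<lambda>\<omega>. ?I \<omega> * (Y t 0 \<omega> - Y b 0 \<omega>))"
      "integrable M (\<lambda>\<omega>. ?I \<omega> * Y b g \<omega>)" "integrable M (\<lambda>\<omega>. ?I \<omega> * Y b 0 \<omega>)"
    using att W lab(1,2) by (simp_all add: ATT_exists_def integrable_uniform_measure_iff[OF A])
  \<comment> \<open>The terms are grouped so that their integrability comes from \<open>att\<close>,
    from \<open>W\<close> and from limited anticipation, in this order.\<close>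
  have e: "?I \<omega> * (Yobs t \<omega> - Yobs b \<omega>) = ?I \<omega> * (Y t g \<omega> - Y t 0 \<omega>)
      + ?I \<omega> * (Y t 0 \<omega> - Y b 0 \<omega>) - (?I \<omega> * Y b g \<omega> - ?I \<omega> * Y b 0 \<omega>)" for \<omega>
    using Yobs_treated[OF g(2), of \<omega>] by (auto simp: treated_in_eq split: split_indicator)
  have iZ: "integrable M (\<lambda>\<omega>. ?I \<omega> * (Yobs t \<omega> - Yobs b \<omega>))"
    unfolding e using i by (intro Bochner_Integration.integrable_add Bochner_Integration.integrable_diff)
  then show "integrable (uniform_measure M (treated_in g)) (\<lambda>\<omega>. Yobs t \<omega> - Yobs b \<omega>)"
    by (simp add: integrable_uniform_measure_iff[OF A])
  have b0: "(\<integral>\<omega>. ?I \<omega> * Y b g \<omega> \<partial>M) = (\<integral>\<omega>. ?I \<omega> * Y b 0 \<omega> \<partial>M)"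
  proof -
    have "(\<integral>\<omega>. ?I \<omega> * Y b g \<omega> \<partial>M) = (\<integral>\<omega>. cexp_on (Y b g) (treated_in g) \<omega> \<partial>M)"
      by (rule sigmaX.real_cond_exp_int(2)[OF i(3), symmetric])
    also have "\<dots> = (\<integral>\<omega>. cexp_on (Y b 0) (treated_in g) \<omega> \<partial>M)"
      by (rule integral_cong_AE[OF _ _ lab(3)]) simp_all
    also have "\<dots> = (\<integral>\<omega>. ?I \<omega> * Y b 0 \<omega> \<partial>M)"
      by (rule sigmaX.real_cond_exp_int(2)[OF i(4)])
    finally show ?thesis .
  qed
  have "?I \<omega> * ((Yobs t \<omega> - Yobs b \<omega>) - (Y t 0 \<omega> - Y b 0 \<omega>)) =
      ?I \<omega> * (Y t g \<omega> - Y t 0 \<omega>) - (?I \<omega> * Y b g \<omega> - ?I \<omega> * Y b 0 \<omega>)" for \<omega>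
    using e[of \<omega>] by (simp add: right_diff_distrib)
  then have "(\<integral>\<omega>. ?I \<omega> * ((Yobs t \<omega> - Yobs b \<omega>) - (Y t 0 \<omega> - Y b 0 \<omega>)) \<partial>M) =
      (\<integral>\<omega>. ?I \<omega> * (Y t g \<omega> - Y t 0 \<omega>) - (?I \<omega> * Y b g \<omega> - ?I \<omega> * Y b 0 \<omega>) \<partial>M)"
    by simp
  also have "\<dots> = (\<integral>\<omega>. ?I \<omega> * (Y t g \<omega> - Y t 0 \<omega>) \<partial>M)"
    using i b0 by simp
  finally show "(\<integral>\<omega>. ?I \<omega> * ((Yobs t \<omega> - Yobs b \<omega>) - (Y t 0 \<omega> - Y b 0 \<omega>)) \<partial>M) /
      prob (treated_in g) = ATT g t"
    by (simp add: ATT_def integral_uniform_measure[OF A])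
qed

lemma observed_trend_never_treated:
  assumes "integrable (uniform_measure M never_treated) (\<lambda>\<omega>. Y t 0 \<omega> - Y b 0 \<omega>)"
    and never: "prob never_treated > 0" and t: "t \<in> {1..T}" and b: "b \<in> {1..T}"
  shows "integrable (uniform_measure M never_treated) (\<lambda>\<omega>. Yobs t \<omega> - Yobs b \<omega>)"
    and "AE \<omega> in M. cexp_on (\<lambda>\<omega>. Yobs t \<omega> - Yobs b \<omega>) never_treated \<omega> =
      cexp_on (\<lambda>\<omega>. Y t 0 \<omega> - Y b 0 \<omega>) never_treated \<omega>"
proof -
  have [measurable]: "Y t 0 \<in> borel_measurable M" "Y b 0 \<in> borel_measurable M"
      "Yobs t \<in> borel_measurable M" "Yobs b \<in> borel_measurable M"
    using t b by (auto intro!: Y_measurable Yobs_measurable)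
  have e: "(\<lambda>\<omega>. indicator never_treated \<omega> * (Yobs t \<omega> - Yobs b \<omega>)) =
      (\<lambda>\<omega>. indicator never_treated \<omega> * (Y t 0 \<omega> - Y b 0 \<omega>) :: real)"
    using Yobs_never_treated by (auto simp: fun_eq_iff never_treated_eq split: split_indicator)
  show "integrable (uniform_measure M never_treated) (\<lambda>\<omega>. Yobs t \<omega> - Yobs b \<omega>)"
    using assms(1) by (simp add: integrable_uniform_measure_iff[OF never_treated_events never] e)
  show "AE \<omega> in M. cexp_on (\<lambda>\<omega>. Yobs t \<omega> - Yobs b \<omega>) never_treated \<omega> =
      cexp_on (\<lambda>\<omega>. Y t 0 \<omega> - Y b 0 \<omega>) never_treated \<omega>"
    unfolding e by simp
qed

text \<open>The control group consists of the never-treated units and of groups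
  \<open>h \<noteq> g\<close> with \<open>s < h\<close>. As t + \<delta> and b + \<delta> are at
  most s, both periods precede any anticipation in such a group, so trading
  \<open>Y t h - Y b h\<close> for the untreated change does not alter the conditional
  expectation.\<close>

lemma observed_trend_not_yet_treated:
  assumes irr: irreversibility and la: "limited_anticipation \<delta>"
    and W: "integrable (uniform_measure M (not_yet_treated g s)) (\<lambda>\<omega>. Y t 0 \<omega> - Y b 0 \<omega>)"
    and never: "prob never_treated > 0" and B: "prob (not_yet_treated g s) > 0"
    and t: "t \<in> {1..T}" "t + \<delta> \<le> s" and b: "b \<in> {1..T}" "b + \<delta> \<le> s" and s: "s \<in> {1..T}"
  shows "integrable (uniform_measure M (not_yet_treated g s)) (\<lambda>\<omega>. Yobs t \<omega> - Yobs b \<omega>)"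
    and "AE \<omega> in M. cexp_on (\<lambda>\<omega>. Yobs t \<omega> - Yobs b \<omega>) (not_yet_treated g s) \<omega> =
      cexp_on (\<lambda>\<omega>. Y t 0 \<omega> - Y b 0 \<omega>) (not_yet_treated g s) \<omega>"
proof -
  let ?B = "not_yet_treated g s"
  let ?I = "\<lambda>h. indicat_real (treated_in h)"
  \<comment> \<open>The condition of positive probability ensures that every member of
    \<open>H\<close> lies in \<open>groups\<close>.\<close>
  define H where "H = {h. h \<le> T \<and> s < h \<and> h \<noteq> g \<and> prob (treated_in h) > 0}"
  \<comment> \<open>The excess of the observed over the untreated change in group \<open>h\<close>.
    The value 0 off \<open>H\<close> makes it integrable with vanishing conditional expectation for
    every \<open>h\<close>.\<close>
  define V where "V h \<omega> = (if h \<in> H then (?I h \<omega> * Y t h \<omega> - ?I h \<omega> * Y t 0 \<omega>) -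
    (?I h \<omega> * Y b h \<omega> - ?I h \<omega> * Y b 0 \<omega>) else 0)" for h \<omega>
  have "finite H"
    by (rule finite_subset[of _ "{..T}"]) (auto simp: H_def)
  note [measurable] = not_yet_treated_events[OF s]
  have [measurable]: "Y t 0 \<in> borel_measurable M" "Y b 0 \<in> borel_measurable M"
      "Yobs t \<in> borel_measurable M" "Yobs b \<in> borel_measurable M"
    using t b by (auto intro!: Y_measurable Yobs_measurable)
  have V: "integrable M (V h)" "AE \<omega> in M. real_cond_exp M sigmaX (V h) \<omega> = 0" for h
  proof -
    have "integrable M (V h) \<and> (AE \<omega> in M. real_cond_exp M sigmaX (V h) \<omega> = 0)"
    proof (cases "h \<in> H")
      case True
      then have h: "h \<in> groups" "h \<in> {2..T}" "t + \<delta> < h" "b + \<delta> < h"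
        using s t b by (auto simp: H_def mem_groups_iff[OF never])
      note A = treated_in_events[of h] groups_prob_pos[OF h(1)]
      have [measurable]: "Y t h \<in> borel_measurable M" "Y b h \<in> borel_measurable M"
        using h t b by (auto intro!: Y_measurable)
      note lat = limited_anticipation_cexp_on[OF la h(1) t(1) h(3)]
      note lab = limited_anticipation_cexp_on[OF la h(1) b(1) h(4)]
      have i: "integrable M (\<lambda>\<omega>. ?I h \<omega> * Y t h \<omega>)" "integrable M (\<lambda>\<omega>. ?I h \<omega> * Y t 0 \<omega>)"
          "integrable M (\<lambda>\<omega>. ?I h \<omega> * Y b h \<omega>)" "integrable M (\<lambda>\<omega>. ?I h \<omega> * Y b 0 \<omega>)"
        using lat(1,2) lab(1,2) by (simp_all add: integrable_uniform_measure_iff[OF A])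
      note d = Bochner_Integration.integrable_diff[OF i(1,2)] Bochner_Integration.integrable_diff[OF i(3,4)]
      have e: "V h = (\<lambda>\<omega>. (?I h \<omega> * Y t h \<omega> - ?I h \<omega> * Y t 0 \<omega>) -
          (?I h \<omega> * Y b h \<omega> - ?I h \<omega> * Y b 0 \<omega>))"
        using True by (simp add: V_def fun_eq_iff)
      have "AE \<omega> in M. real_cond_exp M sigmaX (V h) \<omega> = 0"
        unfolding e
        using sigmaX.real_cond_exp_diff[OF d] sigmaX.real_cond_exp_diff[OF i(1,2)]
          sigmaX.real_cond_exp_diff[OF i(3,4)] lat(3) lab(3)
        by eventually_elim simp
      moreover have "integrable M (V h)"
        unfolding e by (rule Bochner_Integration.integrable_diff[OF d])
      ultimately show ?thesis by blast
    next
      case False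
      then have e: "V h = (\<lambda>_. 0)" by (simp add: V_def fun_eq_iff)
      show ?thesis
        unfolding e by (auto intro: sigmaX.real_cond_exp_F_meas)
    qed
    then show "integrable M (V h)" "AE \<omega> in M. real_cond_exp M sigmaX (V h) \<omega> = 0"
      by blast+
  qed
  \<comment> \<open>The null groups omitted from \<open>H\<close> are finitely many, so together
    they can be ignored.\<close>
  have null: "AE \<omega> in M. \<forall>h\<in>{1..T}. prob (treated_in h) = 0 \<longrightarrow> \<omega> \<notin> treated_in h"
    by (intro AE_finite_allI) (auto simp: prob_eq_0)
  have split: "AE \<omega> in M. indicat_real ?B \<omega> * (Yobs t \<omega> - Yobs b \<omega>) =
      indicator ?B \<omega> * (Y t 0 \<omega> - Y b 0 \<omega>) + (\<Sum>h\<in>H. V h \<omega>)"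
    using irreversibility_iff_less_G[OF irr] null AE_space
  proof eventually_elim
    case (elim \<omega>)
    show ?case
    proof (cases "\<omega> \<in> ?B \<and> G \<omega> \<noteq> \<infinity>")
      case False
      \<comment> \<open>A point of group \<open>h\<close> in \<open>H\<close> has finite
        \<open>G\<close> and lies in \<open>?B\<close>, because \<open>s < h\<close> and
        \<open>h \<noteq> g\<close>; the case excludes this.\<close>
      have "\<omega> \<notin> treated_in h" if "h \<in> H" for h
        using False elim(1) elim(3) s that
        by (auto simp: H_def not_yet_treated_eq treated_in_eq)
      then have "(\<Sum>h\<in>H. V h \<omega>) = 0"
        by (intro sum.neutral) (auto simp: V_def)
      with False show ?thesis
        using Yobs_never_treated[of \<omega>] by (auto split: split_indicator)
    next
      case True
      then obtain h where h: "G \<omega> = enat h" by (cases "G \<omega>") auto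
      with True elim(1) s have "s < h" "h \<noteq> g"
        by (auto simp: not_yet_treated_eq treated_in_eq)
      have hT: "h \<in> {1..T}"
        by (rule G_eq_enatD(1)[OF h])
      have mem: "\<omega> \<in> treated_in h' \<longleftrightarrow> h' = h" for h'
        using h elim(3) by (auto simp: treated_in_eq)
      have "h \<in> H"
        using elim(2) hT \<open>s < h\<close> \<open>h \<noteq> g\<close> mem measure_nonneg[of M "treated_in h"]
        by (auto simp: H_def less_le)
      have "(\<Sum>h\<in>H. V h \<omega>) = (\<Sum>h'\<in>H. if h' = h then V h \<omega> else 0)"
        by (intro sum.cong) (auto simp: V_def mem split: split_indicator)
      also have "\<dots> = V h \<omega>"
        using \<open>finite H\<close> \<open>h \<in> H\<close> by simp
      finally have "(\<Sum>h\<in>H. V h \<omega>) = Y t h \<omega> - Y t 0 \<omega> - (Y b h \<omega> - Y b 0 \<omega>)"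
        using \<open>h \<in> H\<close> by (simp add: V_def mem)
      moreover have "h \<in> {2..T}"
        using hT \<open>s < h\<close> s by auto
      ultimately show ?thesis
        using True Yobs_treated[OF _ h] by simp
    qed
  qed
  have iW: "integrable M (\<lambda>\<omega>. indicator ?B \<omega> * (Y t 0 \<omega> - Y b 0 \<omega>))"
    using W B by (simp add: integrable_uniform_measure_iff)
  have iV: "integrable M (\<lambda>\<omega>. \<Sum>h\<in>H. V h \<omega>)"
    using V by (intro Bochner_Integration.integrable_sum)
  have [measurable]: "V h \<in> borel_measurable M" for h
    using borel_measurable_integrable[OF V(1)] .
  have "integrable M (\<lambda>\<omega>. indicator ?B \<omega> * (Yobs t \<omega> - Yobs b \<omega>))"
    by (rule integrable_cong_AE_imp[OF Bochner_Integration.integrable_add[OF iW iV]])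
       (use split in \<open>auto elim: eventually_mono\<close>)
  then show "integrable (uniform_measure M ?B) (\<lambda>\<omega>. Yobs t \<omega> - Yobs b \<omega>)"
    using B by (simp add: integrable_uniform_measure_iff)
  have "AE \<omega> in M. cexp_on (\<lambda>\<omega>. Yobs t \<omega> - Yobs b \<omega>) ?B \<omega> = real_cond_exp M sigmaX
      (\<lambda>\<omega>. indicator ?B \<omega> * (Y t 0 \<omega> - Y b 0 \<omega>) + (\<Sum>h\<in>H. V h \<omega>)) \<omega>"
    by (rule sigmaX.real_cond_exp_cong[OF split]) measurable
  moreover have "AE \<omega> in M. \<forall>h\<in>H. real_cond_exp M sigmaX (V h) \<omega> = 0"
    using V(2) \<open>finite H\<close> by (intro AE_finite_allI)
  ultimately show "AE \<omega> in M. cexp_on (\<lambda>\<omega>. Yobs t \<omega> - Yobs b \<omega>) ?B \<omega> =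
      cexp_on (\<lambda>\<omega>. Y t 0 \<omega> - Y b 0 \<omega>) ?B \<omega>"
    using sigmaX.real_cond_exp_add[OF iW iV] sigmaX.real_cond_exp_sum[where f = V and I = H, OF V(1)]
    by eventually_elim simp
qed

subsection \<open>Identification\<close>

text \<open>The odds lemma with the conditioning event of \<open>pscore g s\<close> as
  \<open>U\<close>. The event \<open>B\<close> is left open so that both choices of control group
  are covered.\<close>

lemma control_odds:
  assumes "overlap" "g \<in> groups" "s \<in> {2..T}" "B \<in> events" "treated_in g \<inter> B = {}"
    and "AE \<omega> in M. \<omega> \<in> not_yet_treated g s \<longleftrightarrow> \<omega> \<in> B"
  shows "\<exists>K. prob B > 0 \<and>
    (AE \<omega> in M. 0 \<le> pscore g s \<omega> / (1 - pscore g s \<omega>) \<and> pscore g s \<omega> / (1 - pscore g s \<omega>) \<le> K) \<and>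
    (AE \<omega> in M. pscore g s \<omega> / (1 - pscore g s \<omega>) * probX B \<omega> = probX (treated_in g) \<omega>)"
proof -
  obtain \<epsilon> where \<epsilon>: "\<epsilon> > 0" "AE \<omega> in M. pscore g s \<omega> < 1 - \<epsilon>"
    using assms(1-3) unfolding overlap_def by blast
  have s: "s \<in> {1..T}"
    using assms(3) by simp
  let ?U = "treated_in g \<union> not_yet_treated g s"
  have p: "pscore g s = cexpX (indicator (treated_in g)) ?U"
    by (simp add: pscore_def pscore_event_eq[OF s])
  have U: "?U \<in> events"
    using not_yet_treated_events[OF s] by (intro sets.Un treated_in_events)
  have "AE \<omega> in M. \<omega> \<in> ?U \<longleftrightarrow> \<omega> \<in> treated_in g \<union> B"
    using assms(6) by eventually_elim blast
  note * = propensity_odds[OF treated_in_events assms(4) U assms(5) this groups_prob_pos[OF assms(2)]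
      \<epsilon>[unfolded p], folded p]
  show ?thesis
    using * by blast
qed

text \<open>The common core of both parts: \<open>s\<close> is the period of the propensity score,
  \<open>B\<close> an almost sure version of its control group, and \<open>odds\<close> the
  unnormalised control weight.\<close>

lemma identification:
  fixes g t \<delta> :: nat
  assumes la: "limited_anticipation \<delta>" and ov: overlap
    and g: "g \<in> groups_from \<delta>" and t: "t \<in> {2..T}" and s: "s \<in> {2..T}"
    and att: "ATT_exists g t"
    and B: "B \<in> events" "treated_in g \<inter> B = {}"
      "AE \<omega> in M. \<omega> \<in> not_yet_treated g s \<longleftrightarrow> \<omega> \<in> B"
    and odds: "\<And>\<omega>. \<omega> \<in> space M \<Longrightarrow>
      odds \<omega> = pscore g s \<omega> / (1 - pscore g s \<omega>) * indicator B \<omega>"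
  defines "Z \<equiv> \<lambda>\<omega>. Yobs t \<omega> - Yobs (g - \<delta> - 1) \<omega>"
  assumes eq: "cexpX_eq (\<lambda>\<omega>. Y t 0 \<omega> - Y (g - \<delta> - 1) 0 \<omega>) (treated_in g) Z B"
  shows "ATT g t = expectation (\<lambda>\<omega>. (w_treat g \<omega> - odds \<omega> / expectation odds) * Z \<omega>)"
    and "ATT g t = expectation (\<lambda>\<omega>. w_treat g \<omega> * (Z \<omega> - cexpX Z B \<omega>))"
    and "ATT g t =
      expectation (\<lambda>\<omega>. (w_treat g \<omega> - odds \<omega> / expectation odds) * (Z \<omega> - cexpX Z B \<omega>))"
proof -
  let ?b = "g - \<delta> - 1"
  define r where "r \<omega> = pscore g s \<omega> / (1 - pscore g s \<omega>)" for \<omega>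
  \<comment> \<open>From \<open>g \<ge> 2 + \<delta>\<close> the base period is at least 1 and its
    subtraction is not truncated; it is the last period before anticipation can begin.\<close>
  have g': "g \<in> groups" "g \<in> {2..T}" and b: "?b \<in> {1..T}" "?b + \<delta> < g"
    using g by (auto simp: groups_from_def)
  have t': "t \<in> {1..T}"
    using t by simp
  obtain K where K: "prob B > 0" "AE \<omega> in M. 0 \<le> r \<omega> \<and> r \<omega> \<le> K"
      "AE \<omega> in M. r \<omega> * probX B \<omega> = probX (treated_in g) \<omega>"
    using control_odds[OF ov g'(1) s B] unfolding r_def by blast
  have rm: "r \<in> borel_measurable sigmaX"
    unfolding r_def[abs_def] pscore_def by measurable
  have W: "integrable (uniform_measure M (treated_in g)) (\<lambda>\<omega>. Y t 0 \<omega> - Y ?b 0 \<omega>)"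
    using eq by (simp add: cexpX_eq_def)
  note tr = observed_trend_treated[OF la g' t' b att W, folded Z_def]
  have Zeq: "(\<integral>\<omega>. indicator (treated_in g) \<omega> * (Z \<omega> - (Y t 0 \<omega> - Y ?b 0 \<omega>)) \<partial>M) /
      prob (treated_in g) = ATT g t"
    using tr(2) by (simp add: Z_def)
  note we = weighted_estimands[OF treated_in_events B(1) rm groups_prob_pos[OF g'(1)] K eq tr(1),
      unfolded Zeq]
  have w1: "w_treat g \<omega> = indicator (treated_in g) \<omega> / prob (treated_in g)" if "\<omega> \<in> space M" for \<omega>
    using that by (simp add: w_treat_def expectation_Gind Gind_eq_indicator)
  have "expectation odds = expectation (\<lambda>\<omega>. r \<omega> * indicator B \<omega>)"
    by (rule Bochner_Integration.integral_cong) (simp_all add: odds r_def)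
  then have w0: "odds \<omega> / expectation odds =
      r \<omega> * indicator B \<omega> / expectation (\<lambda>\<omega>. r \<omega> * indicator B \<omega>)" if "\<omega> \<in> space M" for \<omega>
    using that by (simp add: odds r_def)
  show "ATT g t = expectation (\<lambda>\<omega>. (w_treat g \<omega> - odds \<omega> / expectation odds) * Z \<omega>)"
    unfolding we(1)[symmetric] by (rule Bochner_Integration.integral_cong) (simp_all only: w0 w1)
  show "ATT g t = expectation (\<lambda>\<omega>. w_treat g \<omega> * (Z \<omega> - cexpX Z B \<omega>))"
    unfolding we(2)[symmetric] by (rule Bochner_Integration.integral_cong) (simp_all only: w1)
  show "ATT g t =
      expectation (\<lambda>\<omega>. (w_treat g \<omega> - odds \<omega> / expectation odds) * (Z \<omega> - cexpX Z B \<omega>))"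
    unfolding we(3)[symmetric] by (rule Bochner_Integration.integral_cong) (simp_all only: w0 w1)
qed

section \<open>The never-treated and the not-yet-treated control groups\<close>

lemma treated_in_inter_control:
  "treated_in g \<inter> never_treated = {}" "treated_in g \<inter> not_yet_treated g s = {}"
  by (auto simp: treated_in_eq never_treated_eq not_yet_treated_eq)

text \<open>In period \<open>T\<close> the control group of the propensity score is the
  never-treated one, and overlap makes any such control group non-null.\<close>

lemma never_treated_prob_pos:
  assumes irreversibility overlap "g \<in> groups"
  shows "prob never_treated > 0"
proof -
  have "T \<in> {2..T}"
    using T_ge_2 by simp
  from control_odds[OF assms(2,3) this never_treated_events treated_in_inter_control(1)
      never_treated_AE_eq[OF assms(1)]]
  show ?thesis by blast
qed

lemma identification_never_treated:
  assumes irr: irreversibility and la: "limited_anticipation \<delta>" and ov: overlap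
    and pt: "parallel_trends_nev \<delta>"
    and g: "g \<in> groups_from \<delta>" and t: "t \<in> {2..T - \<delta>}" "g \<le> t + \<delta>" and att: "ATT_exists g t"
  shows "ATT g t = ATT_nev_ipw g t \<delta>" "ATT g t = ATT_nev_or g t \<delta>" "ATT g t = ATT_nev_dr g t \<delta>"
proof -
  let ?b = "g - \<delta> - 1"
  have g': "g \<in> groups" "2 + \<delta> \<le> g" "g \<le> T" and t': "t \<in> {2..T}" "t \<in> {1..T}"
    and b: "?b \<in> {1..T}" "?b < t"
    using g t by (auto simp: groups_from_def)
  have never: "prob never_treated > 0"
    by (rule never_treated_prob_pos[OF irr ov g'(1)])
  note ev = treated_in_events groups_prob_pos[OF g'(1)] never_treated_events never
  have W: "cexpX_eq (\<lambda>\<omega>. Y t 0 \<omega> - Y ?b 0 \<omega>) (treated_in g)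
      (\<lambda>\<omega>. Y t 0 \<omega> - Y ?b 0 \<omega>) never_treated"
  proof (rule cexpX_eq_telescope[OF ev, where V = "\<lambda>t. Y t 0"])
    fix u assume "?b < u" "u \<le> t"
    \<comment> \<open>The first increment has u = g - \<delta>, exactly where parallel trends set
      in; u is at least 2 because the base period is at least 1.\<close>
    then have "u \<in> {2..T}" "g \<le> u + \<delta>"
      using g' t' by auto
    then show "cexpX_eq (\<lambda>\<omega>. Y u 0 \<omega> - Y (u - 1) 0 \<omega>) (treated_in g)
        (\<lambda>\<omega>. Y u 0 \<omega> - Y (u - 1) 0 \<omega>) never_treated"
      using pt g'(1) unfolding parallel_trends_nev_def by blast
  qed (fact b(2))
  have iW: "integrable (uniform_measure M never_treated) (\<lambda>\<omega>. Y t 0 \<omega> - Y ?b 0 \<omega>)"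
    using W unfolding cexpX_eq_def by blast
  have eq: "cexpX_eq (\<lambda>\<omega>. Y t 0 \<omega> - Y ?b 0 \<omega>) (treated_in g)
      (\<lambda>\<omega>. Yobs t \<omega> - Yobs ?b \<omega>) never_treated"
    by (rule cexpX_eq_replace[OF ev W observed_trend_never_treated[OF iW never t'(2) b(1)]])
  have T: "T \<in> {2..T}"
    using T_ge_2 by simp
  have odds: "odds_nev g \<omega> = pscore g T \<omega> / (1 - pscore g T \<omega>) * indicator never_treated \<omega>"
    if "\<omega> \<in> space M" for \<omega>
    using that by (simp add: odds_nev_def C_def never_treated_eq indicator_def)
  note id = identification[OF la ov g t'(1) T att never_treated_events treated_in_inter_control(1)
      never_treated_AE_eq[OF irr] odds eq]
  show "ATT g t = ATT_nev_ipw g t \<delta>"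
    unfolding ATT_nev_ipw_def w_nev_def by (rule id(1))
  show "ATT g t = ATT_nev_or g t \<delta>"
    unfolding ATT_nev_or_def m_nev_def by (rule id(2))
  show "ATT g t = ATT_nev_dr g t \<delta>"
    unfolding ATT_nev_dr_def w_nev_def m_nev_def by (rule id(3))
qed

text \<open>Parallel trends are used with the fixed period s = t + \<delta> for every increment, so
  that all increments refer to the same control group and can be added up.\<close>

lemma identification_not_yet_treated:
  assumes irr: irreversibility and la: "limited_anticipation \<delta>" and ov: overlap
    and pt: "parallel_trends_ny \<delta>"
    and g: "g \<in> groups_from \<delta>" and t: "t \<in> {2..T - \<delta>}" "g \<le> t + \<delta>" and att: "ATT_exists g t"
  shows "ATT g t = ATT_ny_ipw g t \<delta>" "ATT g t = ATT_ny_or g t \<delta>" "ATT g t = ATT_ny_dr g t \<delta>"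
proof -
  let ?b = "g - \<delta> - 1" and ?s = "t + \<delta>"
  have g': "g \<in> groups" "2 + \<delta> \<le> g" "g \<le> T" and t': "t \<in> {2..T}" "t \<in> {1..T}"
    and b: "?b \<in> {1..T}" "?b < t" "?b + \<delta> \<le> ?s" and s: "?s \<in> {2..T}" "?s \<in> {1..T}"
    using g t by (auto simp: groups_from_def)
  have never: "prob never_treated > 0"
    by (rule never_treated_prob_pos[OF irr ov g'(1)])
  note B = not_yet_treated_events[OF s(2), of g]
  have pos: "prob (not_yet_treated g ?s) > 0"
    using control_odds[OF ov g'(1) s(1) B treated_in_inter_control(2)] by simp
  note ev = treated_in_events groups_prob_pos[OF g'(1)] B pos
  have W: "cexpX_eq (\<lambda>\<omega>. Y t 0 \<omega> - Y ?b 0 \<omega>) (treated_in g)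
      (\<lambda>\<omega>. Y t 0 \<omega> - Y ?b 0 \<omega>) (not_yet_treated g ?s)"
  proof (rule cexpX_eq_telescope[OF ev, where V = "\<lambda>t. Y t 0"])
    fix u assume "?b < u" "u \<le> t"
    then have "u \<in> {2..T}" "g \<le> u + \<delta>" "u + \<delta> \<le> ?s"
      using g' t' by auto
    \<comment> \<open>Overlap has provided never-treated units, hence \<open>gbar\<close> is
      infinite.\<close>
    moreover have "enat ?s < gbar"
      by (simp add: gbar_eq_infinity[OF never])
    ultimately show "cexpX_eq (\<lambda>\<omega>. Y u 0 \<omega> - Y (u - 1) 0 \<omega>) (treated_in g)
        (\<lambda>\<omega>. Y u 0 \<omega> - Y (u - 1) 0 \<omega>) (not_yet_treated g ?s)"
      using pt g'(1) s(1) unfolding parallel_trends_ny_def by blast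
  qed (fact b(2))
  have iW: "integrable (uniform_measure M (not_yet_treated g ?s)) (\<lambda>\<omega>. Y t 0 \<omega> - Y ?b 0 \<omega>)"
    using W unfolding cexpX_eq_def by blast
  have eq: "cexpX_eq (\<lambda>\<omega>. Y t 0 \<omega> - Y ?b 0 \<omega>) (treated_in g)
      (\<lambda>\<omega>. Yobs t \<omega> - Yobs ?b \<omega>) (not_yet_treated g ?s)"
    by (rule cexpX_eq_replace[OF ev W observed_trend_not_yet_treated[OF irr la iW never pos t'(2)
      order_refl b(1,3) s(2)]])
  \<comment> \<open>As \<open>D\<close> and \<open>Gind\<close> take only the values 0 and 1, the
    product of their complements is the indicator of the control group.\<close>
  have odds: "odds_ny g ?s \<omega> = pscore g ?s \<omega> / (1 - pscore g ?s \<omega>) * indicator (not_yet_treated g ?s) \<omega>"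
    if "\<omega> \<in> space M" for \<omega>
    using that D_binary[OF s(2) that]
    by (auto simp: odds_ny_def not_yet_treated_def Gind_def indicator_def)
  have AE: "AE \<omega> in M. \<omega> \<in> not_yet_treated g ?s \<longleftrightarrow> \<omega> \<in> not_yet_treated g ?s"
    by simp
  note id = identification[OF la ov g t'(1) s(1) att B treated_in_inter_control(2) AE odds eq]
  show "ATT g t = ATT_ny_ipw g t \<delta>"
    unfolding ATT_ny_ipw_def w_ny_def by (rule id(1))
  show "ATT g t = ATT_ny_or g t \<delta>"
    unfolding ATT_ny_or_def m_ny_def by (rule id(2))
  show "ATT g t = ATT_ny_dr g t \<delta>"
    unfolding ATT_ny_dr_def w_ny_def m_ny_def by (rule id(3))
qed

end

theorem theorem1:
  fixes M :: "'a measure" and N :: "'b measure"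
    and T \<delta> n :: nat
    and D :: "nat \<Rightarrow> 'a \<Rightarrow> real" and X :: "'a \<Rightarrow> real ^ 'k" and Y :: "nat \<Rightarrow> nat \<Rightarrow> 'a \<Rightarrow> real"
    and Ys :: "nat \<Rightarrow> nat \<Rightarrow> 'b \<Rightarrow> real" and Xs :: "nat \<Rightarrow> 'b \<Rightarrow> real ^ 'k"
    and Ds :: "nat \<Rightarrow> nat \<Rightarrow> 'b \<Rightarrow> real"
  assumes model: "staggered_adoption M T D X Y"
    and irreversible: "staggered_adoption.irreversibility M T D"
    and sampling: "staggered_adoption.random_sampling M T D X Y N n Ys Xs Ds"
    and anticipation: "staggered_adoption.limited_anticipation M T D X Y \<delta>"
    and overlap: "staggered_adoption.overlap M T D X"
    and ATT_exists: "\<forall>g \<in> staggered_adoption.groups_from M T D \<delta>. \<forall>t \<in> {2..T - \<delta>}.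
      g \<le> t + \<delta> \<longrightarrow> staggered_adoption.ATT_exists M T D Y g t"
  shows
    "(staggered_adoption.parallel_trends_nev M T D X Y \<delta> \<longrightarrow>
      (\<forall>g \<in> staggered_adoption.groups_from M T D \<delta>. \<forall>t \<in> {2..T - \<delta>}. g \<le> t + \<delta> \<longrightarrow>
        staggered_adoption.ATT M T D Y g t = staggered_adoption.ATT_nev_ipw M T D X Y g t \<delta> \<and>
        staggered_adoption.ATT M T D Y g t = staggered_adoption.ATT_nev_or M T D X Y g t \<delta> \<and>
        staggered_adoption.ATT M T D Y g t = staggered_adoption.ATT_nev_dr M T D X Y g t \<delta>)) \<and>
     (staggered_adoption.parallel_trends_ny M T D X Y \<delta> \<longrightarrow>
      (\<forall>g \<in> staggered_adoption.groups_from M T D \<delta>. \<forall>t \<in> {2..T - \<delta>}. g \<le> t + \<delta> \<longrightarrow>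
        enat t < staggered_adoption.gbar M T D - enat \<delta> \<longrightarrow>
        staggered_adoption.ATT M T D Y g t = staggered_adoption.ATT_ny_ipw M T D X Y g t \<delta> \<and>
        staggered_adoption.ATT M T D Y g t = staggered_adoption.ATT_ny_or M T D X Y g t \<delta> \<and>
        staggered_adoption.ATT M T D Y g t = staggered_adoption.ATT_ny_dr M T D X Y g t \<delta>))"
proof -
  interpret staggered_adoption M T D X Y
    by (rule model)
  show ?thesis
    using identification_never_treated[OF irreversible anticipation overlap]
      identification_not_yet_treated[OF irreversible anticipation overlap] ATT_exists
    by blast
qed

end
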